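(* Let $1<p,\tau<\infty$, $0<\theta\le\infty$, $b_j>-\frac1\theta$ for $j=1,\dots,m$, $\overline b=(b_1,\dots,b_m)$. Suppose that either $1<\tau\le2$ and $1<p<\infty$, or $2<\tau<\infty$ and $2<p<\infty$, and put $$\gamma=\begin{cases}2,&\text{if }1<\tau\le2\text{ and }1<p<\infty,\\\tau,&\text{if }2<\tau<\infty\text{ and }2<p<\infty,\end{cases}$$ $u_j=b_j+\frac1{\max\{\gamma,\theta\}}$ for $j=1,\dots,m$, and $\overline u=(u_1,\dots,u_m)$. Let $j_0\in\{1,\dots,m\}$ and let $\overline e_{j_0}\in\mathbb{R}^m$ be the point with coordinates $x_j=0$ for $j\ne j_0$ and $x_{j_0}=1$. If $\max\{\gamma,\theta\}=2$, then for any number $\varepsilon>0$ the space $S^{0,\overline b}_{p,\tau,\theta}\mathbf{B}$ is not contained in $S^{0,\overline u+\varepsilon\overline e_{j_0}}_{p,\tau,\theta}B$.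
   Context: $m\in\mathbb{N}$, $\mathbb{T}^m=[0,2\pi)^m$, $\mathbb{Z}_+=\mathbb{N}\cup\{0\}$; $\log$ is the logarithm to base 2; $1/\infty=0$. For $1<p<\infty$, $1\le\tau<\infty$, $L_{p,\tau}(\mathbb{T}^m)$ is the Lorentz space of real-valued measurable functions $f$, $2\pi$-periodic in each variable, with $$\|f\|_{p,\tau}=\Bigl\{\frac{\tau}{p}\int_0^1 (f^*(t))^\tau t^{\frac{\tau}{p}-1}dt\Bigr\}^{1/\tau}<\infty,$$ where $f^*$ is the non-increasing rearrangement of $|f(2\pi\overline x)|$, $\overline x\in[0,1)^m$. $\mathring L_{p,\tau}(\mathbb{T}^m)$ is the set of $f\in L_{p,\tau}(\mathbb{T}^m)$ with $\int_0^{2\pi}f(\overline x)\,dx_j=0$ for $j=1,\dots,m$. For $\overline s\in\mathbb{Z}_+^m$ let $\rho(\overline s)=\{\overline k\in\mathbb{Z}^m: [2^{s_j-1}]\le|k_j|<2^{s_j},\ j=1,\dots,m\}$ ($[a]$ is the integer part of $a$) and $\delta_{\overline s}(f,\overline x)=\sum_{\overline n\in\rho(\overline s)}a_{\overline n}(f)e^{i\langle\overline n,\overline x\rangle}$, where $a_{\overline n}(f)$ are the Fourier coefficients of $f$ with respect to the trigonometric system. $S^{0,\overline r}_{p,\tau,\theta}B$, $\overline r=(r_1,\dots,r_m)$, $r_j>-1/\theta$, is the set of all $f\in\mathring L_{p,\tau}(\mathbb{T}^m)$ with $$\|f\|_{S^{0,\overline r}_{p,\tau,\theta}B}=\Bigl\{\sum_{\overline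 s\in\mathbb{Z}_+^m}\prod_{j=1}^m(s_j+1)^{r_j\theta}\|\delta_{\overline s}(f)\|_{p,\tau}^\theta\Bigr\}^{1/\theta}<\infty.$$ For $\overline k\in\mathbb{N}^m$ the mixed modulus of smoothness is $\omega_{\overline k}(f,\overline t)_{p,\tau}=\sup_{|h_1|\le t_1,\dots,|h_m|\le t_m}\|\Delta_{\overline h}^{\overline k}f\|_{p,\tau}$, where $\Delta_{\overline h}^{\overline k}f=\Delta_{h_m}^{k_m}(\cdots\Delta_{h_1}^{k_1}f)$ and $\Delta_{h_j}^{k_j}$ is the difference of order $k_j$ with step $h_j$ in the variable $x_j$. With $\overline k\in\mathbb{N}^m$ fixed, $S^{0,\overline b}_{p,\tau,\theta}\mathbf{B}$ is the space of all $f\in\mathring L_{p,\tau}(\mathbb{T}^m)$ with $$\|f\|_{S^{0,\overline b}_{p,\tau,\theta}\mathbf{B}}=\|f\|_{p,\tau}+\Bigl[\int_0^1\cdots\int_0^1\omega_{\overline k}^\theta(f,\overline t)_{p,\tau}\prod_{j=1}^m\frac{(1-\log t_j)^{\theta b_j}}{t_j}dt_1\cdots dt_m\Bigr]^{1/\theta}<\infty.$$ When $\theta=\infty$, the $\theta$-sums and $\theta$-integrals are replaced by suprema in the usual way. *)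

theory Defs
  imports "HOL-Analysis.Analysis"
begin

text \<open>
  Points of the \<open>m\<close>-dimensional torus are points of \<^typ>\<open>real ^ 'm\<close>, functions on the torus are
  functions on \<^typ>\<open>real ^ 'm\<close> that are periodic in each variable, and \<open>m\<close> is \<open>CARD('m)\<close>.
  All (quasi-)norms take values in \<^typ>\<open>ennreal\<close>, so that they are defined for every function,
  and the spaces consist of the functions with finite (quasi-)norm.
\<close>

text \<open>Power with a positive real exponent, with \<open>\<infinity>\<^sup>a = \<infinity>\<close>; it is only used for \<open>a > 0\<close>.\<close>

definition enn_powr :: "ennreal \<Rightarrow> real \<Rightarrow> ennreal" where
  "enn_powr x a = (if x = \<infinity> then \<infinity> else ennreal (enn2real x powr a))"

text \<open>
  The non-increasing rearrangement of \<open>x \<mapsto> |f(2\<pi>x)|\<close> on the unit cube. The codomain of \<open>f\<close> is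
  general because the dyadic blocks \<open>\<delta>\<^sub>s(f)\<close> are formally complex-valued.
\<close>

definition rearrangement :: "(real ^ 'm \<Rightarrow> 'a::real_normed_vector) \<Rightarrow> real \<Rightarrow> ennreal" where
  "rearrangement f t = (INF y \<in> {y. 0 \<le> y \<and>
     emeasure lebesgue {x. (\<forall>j. 0 \<le> x $ j \<and> x $ j < 1) \<and> norm (f ((2 * pi) *\<^sub>R x)) > y} \<le> ennreal t}.
     ennreal y)"

definition lorentz_norm ::
    "real \<Rightarrow> real \<Rightarrow> (real ^ 'm \<Rightarrow> 'a::real_normed_vector) \<Rightarrow> ennreal" where
  "lorentz_norm p \<tau> f = enn_powr (ennreal (\<tau> / p) *
     (\<integral>\<^sup>+ t \<in> {0<..<1}. enn_powr (rearrangement f t) \<tau> * ennreal (t powr (\<tau> / p - 1)) \<partial>lborel))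
     (1 / \<tau>)"

definition lorentz_space :: "real \<Rightarrow> real \<Rightarrow> (real ^ 'm \<Rightarrow> real) set" where
  "lorentz_space p \<tau> = {f. f \<in> borel_measurable lebesgue \<and>
     (\<forall>x j. f (x + (2 * pi) *\<^sub>R axis j 1) = f x) \<and> lorentz_norm p \<tau> f < \<infinity>}"

text \<open>
  The mean value in each single variable vanishes for almost all values of the other variables
  (a function in the Lorentz space is integrable over almost all lines, but in general not over all
  of them). The integrand does not depend on \<open>x $ j\<close>.
\<close>

definition lorentz_space0 :: "real \<Rightarrow> real \<Rightarrow> (real ^ 'm \<Rightarrow> real) set" where
  "lorentz_space0 p \<tau> = {f \<in> lorentz_space p \<tau>.
     \<forall>j. AE x in lebesgue. (LINT t:{0..<2 * pi}|lebesgue. f (\<chi> i. if i = j then t else x $ i)) = 0}"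

definition trig :: "int ^ 'm \<Rightarrow> real ^ 'm \<Rightarrow> complex" where
  "trig n x = exp (\<i> * of_real (\<Sum>j\<in>UNIV. of_int (n $ j) * x $ j))"

definition fourier_coeff :: "(real ^ 'm \<Rightarrow> real) \<Rightarrow> int ^ 'm \<Rightarrow> complex" where
  "fourier_coeff f n =
     (LINT x:{x. \<forall>j. 0 \<le> x $ j \<and> x $ j < 2 * pi}|lebesgue. of_real (f x) * cnj (trig n x))
     / of_real ((2 * pi) ^ CARD('m))"

definition dyadic_block :: "nat ^ 'm \<Rightarrow> (int ^ 'm) set" where
  "dyadic_block s =
     {k. \<forall>j. \<lfloor>(2::real) powr (real (s $ j) - 1)\<rfloor> \<le> \<bar>k $ j\<bar> \<and> \<bar>k $ j\<bar> < 2 ^ (s $ j)}"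

lemma finite_dyadic_block: "finite (dyadic_block s)"
proof -
  let ?F = "PiE UNIV (\<lambda>j. {- (2 ^ (s $ j)) .. (2 ^ (s $ j) :: int)})"
  have "finite (vec_lambda ` ?F)"
    by (intro finite_imageI finite_PiE) auto
  moreover have "k \<in> vec_lambda ` ?F" if "k \<in> dyadic_block s" for k
  proof (rule image_eqI)
    show "k = vec_lambda (vec_nth k)"
      by (rule vec_nth_inverse [symmetric])
    have "k $ j \<in> {- (2 ^ (s $ j)) .. 2 ^ (s $ j)}" for j
    proof -
      have "\<bar>k $ j\<bar> < 2 ^ (s $ j)"
        using that unfolding dyadic_block_def by blast
      then show ?thesis
        unfolding atLeastAtMost_iff by linarith
    qed
    then show "vec_nth k \<in> ?F"
      by (intro PiE_I) auto
  qed
  ultimately show ?thesis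
    by (meson finite_subset subsetI)
qed

definition delta_block :: "nat ^ 'm \<Rightarrow> (real ^ 'm \<Rightarrow> real) \<Rightarrow> real ^ 'm \<Rightarrow> complex" where
  "delta_block s f x = (\<Sum>n\<in>dyadic_block s. fourier_coeff f n * trig n x)"

text \<open>
  The spaces defined by dyadic blocks (\<open>besov_block\<close>) and by the mixed modulus of smoothness
  (\<open>besov_mod\<close>); the outer exponent \<open>\<theta>\<close> may be \<open>\<infinity>\<close>.
\<close>

definition besov_block_norm ::
    "real \<Rightarrow> real \<Rightarrow> ereal \<Rightarrow> real ^ 'm \<Rightarrow> (real ^ 'm \<Rightarrow> real) \<Rightarrow> ennreal" where
  "besov_block_norm p \<tau> \<theta> r f =
     (if \<theta> = \<infinity>
      then (SUP s. ennreal (\<Prod>j\<in>UNIV. (real (s $ j) + 1) powr (r $ j)) *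
              lorentz_norm p \<tau> (delta_block s f))
      else (let q = real_of_ereal \<theta> in
        enn_powr (\<Sum>\<^sub>\<infinity>s. ennreal (\<Prod>j\<in>UNIV. (real (s $ j) + 1) powr (r $ j * q)) *
              enn_powr (lorentz_norm p \<tau> (delta_block s f)) q) (1 / q)))"

definition besov_block :: "real \<Rightarrow> real \<Rightarrow> ereal \<Rightarrow> real ^ 'm \<Rightarrow> (real ^ 'm \<Rightarrow> real) set" where
  "besov_block p \<tau> \<theta> r = {f \<in> lorentz_space0 p \<tau>. besov_block_norm p \<tau> \<theta> r f < \<infinity>}"

definition diff_step :: "'m \<Rightarrow> real \<Rightarrow> (real ^ 'm \<Rightarrow> real) \<Rightarrow> real ^ 'm \<Rightarrow> real" where
  "diff_step j h f = (\<lambda>x. f (x + h *\<^sub>R axis j 1) - f x)"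

definition partial_diff :: "'m \<Rightarrow> nat \<Rightarrow> real \<Rightarrow> (real ^ 'm \<Rightarrow> real) \<Rightarrow> real ^ 'm \<Rightarrow> real" where
  "partial_diff j k h = (diff_step j h ^^ k)"

text \<open>
  The composition of the partial differences over all variables. The index type carries no order,
  but the partial differences commute, so the fold does not depend on the order.
\<close>

definition mixed_diff :: "nat ^ 'm \<Rightarrow> real ^ 'm \<Rightarrow> (real ^ 'm \<Rightarrow> real) \<Rightarrow> real ^ 'm \<Rightarrow> real" where
  "mixed_diff k h f = Finite_Set.fold (\<lambda>j. partial_diff j (k $ j) (h $ j)) f UNIV"

lemma diff_step_commute: "diff_step i a \<circ> diff_step j b = diff_step j b \<circ> diff_step i a"
  by (simp add: fun_eq_iff diff_step_def algebra_simps)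

lemma funpow_commute:
  assumes "f \<circ> g = g \<circ> f"
  shows "(f ^^ m) \<circ> (g ^^ n) = (g ^^ n) \<circ> (f ^^ m)"
proof -
  have *: "f ((g ^^ n) x) = (g ^^ n) (f x)" for n x
    using assms by (induction n) (simp_all add: fun_eq_iff)
  have "(f ^^ m) ((g ^^ n) x) = (g ^^ n) ((f ^^ m) x)" for x
    by (induction m) (simp_all add: *)
  then show ?thesis
    by (simp add: fun_eq_iff)
qed

lemma comp_fun_commute_partial_diff:
  "comp_fun_commute (\<lambda>j. partial_diff j (k $ j) (h $ j))"
  unfolding partial_diff_def
  by unfold_locales (rule funpow_commute, rule diff_step_commute)

definition mixed_modulus ::
    "nat ^ 'm \<Rightarrow> real \<Rightarrow> real \<Rightarrow> (real ^ 'm \<Rightarrow> real) \<Rightarrow> real ^ 'm \<Rightarrow> ennreal" where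
  "mixed_modulus k p \<tau> f t = (SUP h\<in>{h. \<forall>j. \<bar>h $ j\<bar> \<le> t $ j}. lorentz_norm p \<tau> (mixed_diff k h f))"

definition besov_mod_norm ::
    "nat ^ 'm \<Rightarrow> real \<Rightarrow> real \<Rightarrow> ereal \<Rightarrow> real ^ 'm \<Rightarrow> (real ^ 'm \<Rightarrow> real) \<Rightarrow> ennreal" where
  "besov_mod_norm k p \<tau> \<theta> b f = lorentz_norm p \<tau> f +
     (if \<theta> = \<infinity>
      then (SUP t\<in>{t. \<forall>j. 0 < t $ j \<and> t $ j \<le> 1}.
              mixed_modulus k p \<tau> f t * ennreal (\<Prod>j\<in>UNIV. (1 - log 2 (t $ j)) powr (b $ j)))
      else (let q = real_of_ereal \<theta> in
        enn_powr (\<integral>\<^sup>+ t \<in> {t. \<forall>j. 0 < t $ j \<and> t $ j \<le> 1}.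
              enn_powr (mixed_modulus k p \<tau> f t) q *
              ennreal (\<Prod>j\<in>UNIV. (1 - log 2 (t $ j)) powr (q * b $ j) / t $ j) \<partial>lebesgue) (1 / q)))"

definition besov_mod ::
    "nat ^ 'm \<Rightarrow> real \<Rightarrow> real \<Rightarrow> ereal \<Rightarrow> real ^ 'm \<Rightarrow> (real ^ 'm \<Rightarrow> real) set" where
  "besov_mod k p \<tau> \<theta> b = {f \<in> lorentz_space0 p \<tau>. besov_mod_norm k p \<tau> \<theta> b f < \<infinity>}"

end

theory Submission
  imports Defs
begin

text \<open>
  Since \<open>max \<gamma> \<theta> = 2\<close> forces \<open>\<tau> \<le> 2\<close> and \<open>\<theta> \<le> 2\<close>, we have \<open>u\<^sub>j = b\<^sub>j + 1/2\<close>. The counterexample is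
  \<open>f(x) = g(x\<^sub>i) \<Prod>j\<noteq>i. cos x\<^sub>j\<close> with \<open>i = j\<^sub>0\<close> and a lacunary series \<open>g(y) = \<Sum>n. a\<^sub>n cos (2\<^sup>n y)\<close>, where
  \<open>a\<^sub>n\<^sup>2 = (n+1) powr (-2\<eta>) - (n+2) powr (-2\<eta>)\<close> and \<open>\<eta> = b\<^sub>i + 1/\<theta> + \<epsilon>\<close>. A lacunary series has
  sub-Gaussian tails governed by the \<open>\<ell>\<^sup>2\<close> norm of its coefficients, so its modulus of smoothness
  at \<open>t\<close> is \<open>O((1 - log t) powr (-\<eta>))\<close>, which is just integrable enough for the modulus space. Each
  dyadic block, however, contains a single term of size \<open>a\<^sub>n \<approx> n powr (-\<eta>-1/2)\<close>, so that the
  \<open>\<theta>\<close>-sum of the block norm is bounded from below by the harmonic series.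
\<close>

section \<open>Exponential moments of lacunary sums\<close>

text \<open>The modulus norm is finite once \<eta> exceeds b + 1/\<theta> at \<open>j0\<close>. With
  block weight b + 1/2 + \<epsilon> at \<open>j0\<close>, the block norm is infinite as long as
  \<eta> is at most b + 1/\<theta> + \<epsilon>. So \<epsilon> is the width of the admissible range
  for \<eta>, and its right end is taken because the block terms then match the harmonic series
  exactly. The 1/2 is the gap between the root of a tail of the square sum, of order n powr
  (-\<eta>), and a single coefficient. The obstacle is that for small \<eta> the coefficients are
  square summable but not summable, so the series converges only almost everywhere and along sparse
  partial sums. Hence the moment estimates are proved for finite sums with arbitrary phases,
  uniformly in their length, and are carried to the limit by Fatou's lemma. Exponential moments
  serve all p and \<tau> at once. The cosine factors have mean zero, and their differences are O(t),
  negligible against every power of the logarithm.\<close>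

lemma cosh_le_exp_square:
  fixes x :: real
  shows "cosh x \<le> exp (x\<^sup>2 / 2)"
proof -
  have c: "(\<lambda>n. if even n then x ^ n /\<^sub>R fact n else 0) sums cosh x"
    by (rule cosh_converges)
  have "(\<lambda>n. (x ^ (2 * n)) /\<^sub>R fact (2 * n)) sums cosh x"
  proof -
    have "strict_mono (\<lambda>n::nat. 2 * n)"
      by (simp add: strict_mono_def)
    moreover have "(if even n then x ^ n /\<^sub>R fact n else 0) = 0" if "n \<notin> range (\<lambda>n::nat. 2 * n)" for n
      using that by (auto elim: evenE)
    ultimately show ?thesis
      using sums_mono_reindex[of "\<lambda>n. 2 * n" "\<lambda>n. if even n then x ^ n /\<^sub>R fact n else 0" "cosh x"] c
      by simp
  qed
  moreover have "(\<lambda>n. ((x\<^sup>2 / 2) ^ n) /\<^sub>R fact n) sums exp (x\<^sup>2 / 2)"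
    by (rule exp_converges)
  moreover have "(x ^ (2 * n)) /\<^sub>R fact (2 * n) \<le> ((x\<^sup>2 / 2) ^ n) /\<^sub>R fact n" for n
  proof -
    \<comment> \<open>This inequality compares the two power series term by term. The resulting
      bound on \<open>cosh\<close> is the exponential moment of a fair random sign.\<close>
    have "(2::nat) ^ n * fact n \<le> fact (2 * n)"
    proof (induction n)
      case (Suc n)
      have "(2::nat) ^ Suc n * fact (Suc n) = (2 * n + 2) * (2 ^ n * fact n)"
        by (simp add: algebra_simps)
      also have "\<dots> \<le> (2 * n + 2) * fact (2 * n)"
        using Suc by (intro mult_left_mono) auto
      also have "\<dots> \<le> (2 * n + 2) * ((2 * n + 1) * fact (2 * n))"
        by (intro mult_left_mono) auto
      also have "\<dots> = fact (2 * Suc n)"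
        by (simp add: algebra_simps)
      finally show ?case .
    qed simp
    then have "real (2 ^ n * fact n) \<le> real (fact (2 * n))"
      by (rule of_nat_mono)
    then have "(2::real) ^ n * fact n \<le> fact (2 * n)"
      by simp
    then have "(x\<^sup>2) ^ n / fact (2 * n) \<le> (x\<^sup>2) ^ n / (2 ^ n * fact n)"
      by (intro divide_left_mono) auto
    then show ?thesis
      by (simp only: power_mult power_divide) (simp add: divide_inverse algebra_simps)
  qed
  ultimately show ?thesis
    by (rule sums_le[rotated])
qed

text \<open>The phases make the class closed under translations and differences, which only change
  amplitudes and phases. One moment bound therefore also covers all shifted and differenced
  sums.\<close>

definition lacunary_sum :: "(nat \<Rightarrow> real) \<Rightarrow> (nat \<Rightarrow> real) \<Rightarrow> nat \<Rightarrow> real \<Rightarrow> real" where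
  "lacunary_sum c \<phi> M y = (\<Sum>n<M. c n * cos (2 ^ n * y + \<phi> n))"

lemma lacunary_sum_measurable [measurable]: "lacunary_sum c \<phi> M \<in> borel_measurable borel"
  unfolding lacunary_sum_def by measurable

lemma continuous_on_lacunary_sum [continuous_intros]:
  fixes f :: "'a::t2_space \<Rightarrow> real"
  shows "continuous_on A f \<Longrightarrow> continuous_on A (\<lambda>x. lacunary_sum c \<phi> M (f x))"
  unfolding lacunary_sum_def by (intro continuous_intros)

lemma cos_plus_int_2pi: "cos (x + 2 * pi * of_int n) = cos x"
  using cos_integer_2pi[of "of_int n"] sin_integer_2pi[of "of_int n"]
  by (simp add: cos_add)

lemma lacunary_sum_periodic: "lacunary_sum c \<phi> M (y + 2 * pi) = lacunary_sum c \<phi> M y"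
proof -
  have "cos (2 ^ n * (y + 2 * pi) + \<phi> n) = cos (2 ^ n * y + \<phi> n)" for n
    using cos_plus_int_2pi[of "2 ^ n * y + \<phi> n" "2 ^ n"] by (simp add: algebra_simps)
  then show ?thesis
    by (simp add: lacunary_sum_def)
qed

text \<open>
  The shift by \<open>1/2\<close> changes the sign of the term of lowest frequency and fixes all the others, so
  the terms contribute one by one like independent symmetric random variables.
\<close>

lemma integral_exp_lacunary_sum:
  "integral {0..1} (\<lambda>x. exp (lacunary_sum c \<phi> M (2 * pi * x))) \<le> exp ((\<Sum>n<M. (c n)\<^sup>2) / 2)"
proof (induction M arbitrary: c \<phi>)
  case 0
  show ?case by (simp add: lacunary_sum_def)
next
  case (Suc M)
  \<comment> \<open>The terms of higher frequency form a lacunary sum with shifted index at the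
    doubled argument, so the induction hypothesis bounds the integral of \<open>H\<close> for the
    shifted amplitudes and phases.\<close>
  define H where "H x = exp (lacunary_sum (\<lambda>n. c (Suc n)) (\<lambda>n. \<phi> (Suc n)) M (2 * pi * x))" for x
  define u where "u x = c 0 * cos (2 * pi * x + \<phi> 0)" for x
  have F: "exp (lacunary_sum c \<phi> (Suc M) (2 * pi * x)) = exp (u x) * H (2 * x)" for x
    unfolding lacunary_sum_def H_def u_def
    by (subst sum.lessThan_Suc_shift) (simp add: exp_add algebra_simps)
  have contH: "continuous_on A (\<lambda>x. H (f x))" if "continuous_on A f" for A and f :: "real \<Rightarrow> real"
    unfolding H_def by (intro continuous_intros that)
  have contu: "continuous_on A (\<lambda>x. u (f x))" if "continuous_on A f" for A and f :: "real \<Rightarrow> real"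
    unfolding u_def by (intro continuous_intros that)
  have Hper: "H (2 * (x + 1/2)) = H (2 * x)" for x
    unfolding H_def using lacunary_sum_periodic[of _ _ M "2 * pi * (2 * x)"]
    by (simp add: algebra_simps)
  have uneg: "u (x + 1/2) = - u x" for x
  proof -
    have "2 * pi * (x + 1/2) + \<phi> 0 = (2 * pi * x + \<phi> 0) + pi"
      by (simp add: algebra_simps)
    then show ?thesis
      unfolding u_def by (simp only: cos_periodic_pi mult_minus_right)
  qed
  let ?F = "\<lambda>x. exp (u x) * H (2 * x)"
  have "integral {0..1} ?F = integral {0..1/2} ?F + integral {1/2..1} ?F"
    by (rule Henstock_Kurzweil_Integration.integral_combine[symmetric])
      (auto intro!: integrable_continuous_real continuous_intros contH contu)
  also have "integral {1/2..1} ?F = integral {0..1/2} (\<lambda>x. exp (- u x) * H (2 * x))"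
    using integral_shift[of 0 "1/2" "1/2" ?F] uneg Hper
    by (simp add: comp_def continuous_intros contH contu)
  also have "integral {0..1/2} ?F + \<dots> = integral {0..1/2} (\<lambda>x. exp (u x) * H (2 * x) + exp (- u x) * H (2 * x))"
    by (rule integral_add[symmetric])
      (auto intro!: integrable_continuous_real continuous_intros contH contu)
  also have "\<dots> \<le> integral {0..1/2} (\<lambda>x. 2 * exp ((c 0)\<^sup>2 / 2) * H (2 * x))"
  proof (rule integral_le)
    fix x :: real
    have "exp (u x) + exp (- u x) = 2 * cosh (u x)"
      by (simp add: cosh_def)
    also have "\<dots> \<le> 2 * exp ((u x)\<^sup>2 / 2)"
      using cosh_le_exp_square[of "u x"] by simp
    also have "\<dots> \<le> 2 * exp ((c 0)\<^sup>2 / 2)"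
    proof -
      have "(u x)\<^sup>2 = (c 0)\<^sup>2 * (cos (2 * pi * x + \<phi> 0))\<^sup>2"
        by (simp add: u_def power_mult_distrib)
      also have "\<dots> \<le> (c 0)\<^sup>2 * 1"
        by (intro mult_left_mono) (auto simp: abs_square_le_1)
      finally show ?thesis by simp
    qed
    finally have "(exp (u x) + exp (- u x)) * H (2 * x) \<le> 2 * exp ((c 0)\<^sup>2 / 2) * H (2 * x)"
      by (rule mult_right_mono) (simp add: H_def)
    then show "exp (u x) * H (2 * x) + exp (- u x) * H (2 * x) \<le> 2 * exp ((c 0)\<^sup>2 / 2) * H (2 * x)"
      by (simp add: algebra_simps)
  qed (auto intro!: integrable_continuous_real continuous_intros contH contu)
  also have "\<dots> = exp ((c 0)\<^sup>2 / 2) * integral {0..1} H"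
  proof -
    have "(H has_integral integral {0..1} H) (cbox 0 1)"
      using integrable_continuous_real[OF contH[of "{0..1}" "\<lambda>x. x"]]
      by (simp add: integrable_integral continuous_on_id)
    from has_integral_affinity'[OF this, of 2 0]
    have "((\<lambda>x. H (2 * x)) has_integral integral {0..1} H / 2) {0..1/2}"
      by simp
    then show ?thesis
      by (simp add: integral_unique)
  qed
  also have "\<dots> \<le> exp ((c 0)\<^sup>2 / 2) * exp ((\<Sum>n<M. (c (Suc n))\<^sup>2) / 2)"
    unfolding H_def by (intro mult_left_mono Suc) simp
  also have "\<dots> = exp ((\<Sum>n<Suc M. (c n)\<^sup>2) / 2)"
    by (subst sum.lessThan_Suc_shift) (simp add: exp_add[symmetric] add_divide_distrib)
  finally show ?case
    by (simp add: F)
qed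

text \<open>The absolute value is removed by exp |z| \<le> exp z + exp (-z). After division by
  \<sigma> both signs give sums with square sum at most 1 and hence moment at most exp (1/2) \<le>
  2. This is the source of the 4 in all later moment and tail bounds.\<close>

lemma nn_integral_exp_lacunary_sum:
  assumes "(\<Sum>n<M. (c n)\<^sup>2) \<le> \<sigma>\<^sup>2" and "\<sigma> > 0"
  shows "(\<integral>\<^sup>+ x \<in> {0..<1}. ennreal (exp (\<bar>lacunary_sum c \<phi> M (2 * pi * x)\<bar> / \<sigma>)) \<partial>lborel) \<le> 4"
proof -
  have *: "(\<integral>\<^sup>+ x \<in> {0..1}. ennreal (exp (lacunary_sum c' \<phi> M (2 * pi * x))) \<partial>lborel) \<le> ennreal 2"
    if "(\<Sum>n<M. (c' n)\<^sup>2) \<le> 1" for c'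
  proof -
    let ?f = "\<lambda>x. exp (lacunary_sum c' \<phi> M (2 * pi * x))"
    have "(?f has_integral integral {0..1} ?f) {0..1}"
      by (intro integrable_integral integrable_continuous_real continuous_intros)
    then have "(\<integral>\<^sup>+ x \<in> {0..1}. ennreal (?f x) \<partial>lborel) = ennreal (integral {0..1} ?f)"
      using nn_integral_has_integral_lebesgue[of "{0..1}" ?f] 
      by (simp add: mult.commute ennreal_mult' ennreal_indicator)
    also have "integral {0..1} ?f \<le> exp ((\<Sum>n<M. (c' n)\<^sup>2) / 2)"
      by (rule integral_exp_lacunary_sum)
    also have "\<dots> \<le> exp (1/2)"
      using that by simp
    also have "\<dots> \<le> 2"
      using exp_bound_half[of "1/2::real"] by simp
    finally show ?thesis
      by (simp add: ennreal_leI)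
  qed
  have sc: "lacunary_sum c \<phi> M y / \<sigma> = lacunary_sum (\<lambda>n. c n / \<sigma>) \<phi> M y" 
    "- (lacunary_sum c \<phi> M y / \<sigma>) = lacunary_sum (\<lambda>n. - (c n / \<sigma>)) \<phi> M y" for y
    by (simp_all add: lacunary_sum_def sum_divide_distrib sum_negf)
  have le: "(\<Sum>n<M. (c n / \<sigma>)\<^sup>2) \<le> 1" 
    using assms by (simp add: power_divide sum_divide_distrib[symmetric])
  have "(\<integral>\<^sup>+ x \<in> {0..<1}. ennreal (exp (\<bar>lacunary_sum c \<phi> M (2 * pi * x)\<bar> / \<sigma>)) \<partial>lborel)
    \<le> (\<integral>\<^sup>+ x. ennreal (exp (lacunary_sum (\<lambda>n. c n / \<sigma>) \<phi> M (2 * pi * x))) * indicator {0..1} x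
        + ennreal (exp (lacunary_sum (\<lambda>n. - (c n / \<sigma>)) \<phi> M (2 * pi * x))) * indicator {0..1} x \<partial>lborel)"
    by (intro nn_integral_mono) 
      (auto simp: sc[symmetric] abs_if ennreal_plus[symmetric] simp del: ennreal_plus minus_divide_left
        split: split_indicator intro!: ennreal_leI)
  also have "\<dots> \<le> ennreal 2 + ennreal 2"
    by (subst nn_integral_add, simp, simp, intro add_mono *) (use le in \<open>simp_all\<close>)
  finally show ?thesis
    by (simp flip: ennreal_plus)
qed

section \<open>Lorentz norms and product integrals\<close>

lemma enn_powr_ennreal: "0 \<le> x \<Longrightarrow> enn_powr (ennreal x) a = ennreal (x powr a)"
  by (simp add: enn_powr_def)

lemma enn_powr_mono:
  assumes "x \<le> y" "0 \<le> a"
  shows "enn_powr x a \<le> enn_powr y a"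
proof (cases "y = \<infinity>")
  case False
  then have "x \<noteq> \<infinity>" using assms neq_top_trans by auto
  with False show ?thesis
    using assms by (auto simp: enn_powr_def top.not_eq_extremum intro!: ennreal_leI powr_mono2 enn2real_mono)
qed (simp add: enn_powr_def)

lemma enn_powr_less_top: "x < \<infinity> \<Longrightarrow> enn_powr x a < \<infinity>"
  by (simp add: enn_powr_def)

lemma nn_integral_powr_Ioo:
  fixes e \<kappa> :: real
  assumes "e > 0" "\<kappa> \<ge> 0"
  shows "(\<integral>\<^sup>+ t \<in> {0<..<\<kappa>}. ennreal (t powr (e - 1)) \<partial>lborel) = ennreal (\<kappa> powr e / e)"
proof -
  have "((\<lambda>t. t powr (e - 1)) has_integral (\<kappa> powr e / e)) {0<..<\<kappa>}"
    using has_integral_powr_from_0[of "e - 1" \<kappa>] assms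
    by (simp add: has_integral_Icc_iff_Ioo)
  from nn_integral_has_integral_lebesgue[OF _ this] show ?thesis
    by (simp add: mult.commute ennreal_mult' ennreal_indicator)
qed

lemma rearrangement_le:
  assumes "0 \<le> y"
    and "emeasure lebesgue {x. (\<forall>j. 0 \<le> x $ j \<and> x $ j < 1) \<and> norm (f ((2 * pi) *\<^sub>R x)) > y} \<le> ennreal t"
  shows "rearrangement f t \<le> ennreal y"
  unfolding rearrangement_def using assms by (intro INF_lower) auto

lemma rearrangement_ge:
  assumes "\<And>y. 0 \<le> y \<Longrightarrow> y < v \<Longrightarrow>
    ennreal t < emeasure lebesgue {x. (\<forall>j. 0 \<le> x $ j \<and> x $ j < 1) \<and> norm (f ((2 * pi) *\<^sub>R x)) > y}"
  shows "ennreal v \<le> rearrangement f t"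
  unfolding rearrangement_def
proof (intro INF_greatest)
  fix y assume "y \<in> {y. 0 \<le> y \<and> emeasure lebesgue {x. (\<forall>j. 0 \<le> x $ j \<and> x $ j < 1) \<and>
    norm (f ((2 * pi) *\<^sub>R x)) > y} \<le> ennreal t}"
  then have "\<not> y < v"
    using assms[of y] by (auto simp: not_less[symmetric])
  then show "ennreal v \<le> ennreal y"
    by (simp add: ennreal_leI)
qed

text \<open>
  The tail bound gives \<open>f\<^sup>*(t) \<le> \<sigma> ln (4 / t) \<le> 2 p \<sigma> (4 / t) powr (1 / (2 p))\<close>.
\<close>

lemma lorentz_norm_le_of_exp_tail:
  fixes f :: "real ^ 'm \<Rightarrow> 'a::real_normed_vector"
  assumes p: "p > 0" and tau: "\<tau> > 0" and s: "\<sigma> > 0"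
    and tail: "\<And>y. 0 \<le> y \<Longrightarrow> emeasure lebesgue {x. (\<forall>j. 0 \<le> x $ j \<and> x $ j < 1) \<and>
      norm (f ((2 * pi) *\<^sub>R x)) > y} \<le> ennreal (4 * exp (- (y / \<sigma>)))"
  shows "lorentz_norm p \<tau> f \<le> ennreal (2 powr (1 / \<tau>) * (2 * p * 4 powr (1 / (2 * p))) * \<sigma>)"
proof -
  define A where "A = 2 * p * 4 powr (1 / (2 * p)) * \<sigma>"
  have A: "A > 0" using p s by (simp add: A_def)
  have *: "enn_powr (rearrangement f t) \<tau> * ennreal (t powr (\<tau> / p - 1))
      \<le> ennreal (A powr \<tau>) * ennreal (t powr (\<tau> / (2 * p) - 1))" if t: "0 < t" "t < 1" for t
  proof -
    \<comment> \<open>The level at which the assumed tail bound equals \<open>t\<close>.\<close>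
    define y where "y = \<sigma> * ln (4 / t)"
    have "y \<ge> 0" using t s by (simp add: y_def)
    have "exp (- ln (4 / t)) = t / 4"
      using t by (subst exp_minus, subst exp_ln) auto
    then have "4 * exp (- (y / \<sigma>)) = t"
      using s by (simp add: y_def)
    with tail[OF \<open>y \<ge> 0\<close>] have "rearrangement f t \<le> ennreal y"
      using rearrangement_le[OF \<open>y \<ge> 0\<close>, of f t] by simp
    also have "y \<le> A * t powr (- 1 / (2 * p))"
    proof -
      \<comment> \<open>The exponent 1/(2p) is half of the critical 1/p, so that the bound raised to
        the power \<tau> stays integrable at 0 against the Lorentz weight
        \<open>t powr (\<tau> / p - 1)\<close>.\<close>
      have "ln (4 / t) \<le> (4 / t) powr (1 / (2 * p)) / (1 / (2 * p))"
        using t p by (intro ln_powr_bound) auto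
      also have "\<dots> = 2 * p * 4 powr (1 / (2 * p)) * t powr (- 1 / (2 * p))"
        using t p by (simp add: powr_divide powr_minus_divide)
      finally have "\<sigma> * ln (4 / t) \<le> \<sigma> * (2 * p * 4 powr (1 / (2 * p)) * t powr (- 1 / (2 * p)))"
        using s by (intro mult_left_mono) auto
      then show ?thesis
        by (simp add: y_def A_def mult_ac)
    qed
    finally have "rearrangement f t \<le> ennreal (A * t powr (- 1 / (2 * p)))"
      by (simp add: ennreal_leI)
    then have "enn_powr (rearrangement f t) \<tau> \<le> enn_powr (ennreal (A * t powr (- 1 / (2 * p)))) \<tau>"
      using tau by (intro enn_powr_mono) auto
    also have "\<dots> = ennreal (A powr \<tau> * t powr (- \<tau> / (2 * p)))"
      using A by (simp add: enn_powr_ennreal powr_mult powr_powr)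
    finally have "enn_powr (rearrangement f t) \<tau> * ennreal (t powr (\<tau> / p - 1))
      \<le> ennreal (A powr \<tau> * t powr (- \<tau> / (2 * p))) * ennreal (t powr (\<tau> / p - 1))"
      by (rule mult_right_mono) simp
    also have "\<dots> = ennreal (A powr \<tau> * (t powr (- \<tau> / (2 * p)) * t powr (\<tau> / p - 1)))"
      by (simp flip: ennreal_mult add: mult.assoc)
    also have "t powr (- \<tau> / (2 * p)) * t powr (\<tau> / p - 1) = t powr (\<tau> / (2 * p) - 1)"
    proof -
      have "- \<tau> / (2 * p) + (\<tau> / p - 1) = \<tau> / (2 * p) - 1"
        using p by (simp add: field_simps)
      then show ?thesis
        by (simp only: powr_add[symmetric])
    qed
    finally show ?thesis
      by (simp add: ennreal_mult)
  qed
  have "(\<integral>\<^sup>+ t \<in> {0<..<1}. enn_powr (rearrangement f t) \<tau> * ennreal (t powr (\<tau> / p - 1)) \<partial>lborel)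
    \<le> (\<integral>\<^sup>+ t. ennreal (A powr \<tau>) * (ennreal (t powr (\<tau> / (2 * p) - 1)) * indicator {0<..<1} t) \<partial>lborel)"
    using * by (intro nn_integral_mono) (auto split: split_indicator)
  also have "\<dots> = ennreal (A powr \<tau>) * ennreal (1 / (\<tau> / (2 * p)))"
    using nn_integral_powr_Ioo[of "\<tau> / (2 * p)" 1] p tau
    by (subst nn_integral_cmult) auto
  finally have "ennreal (\<tau> / p) *
      (\<integral>\<^sup>+ t \<in> {0<..<1}. enn_powr (rearrangement f t) \<tau> * ennreal (t powr (\<tau> / p - 1)) \<partial>lborel)
    \<le> ennreal (\<tau> / p) * (ennreal (A powr \<tau>) * ennreal (1 / (\<tau> / (2 * p))))"
    by (rule mult_left_mono) simp
  \<comment> \<open>The weight integral is 2p/\<tau>, and the normalisation \<tau>/p leaves the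
    factor 2.\<close>
  also have "\<dots> = ennreal (2 * A powr \<tau>)"
    using p tau by (simp flip: ennreal_mult)
  finally have "lorentz_norm p \<tau> f \<le> enn_powr (ennreal (2 * A powr \<tau>)) (1 / \<tau>)"
    unfolding lorentz_norm_def using tau by (intro enn_powr_mono) auto
  also have "\<dots> = ennreal (2 powr (1 / \<tau>) * A)"
    using A tau by (simp add: enn_powr_ennreal powr_mult powr_powr)
  finally show ?thesis
    by (simp add: A_def mult.assoc)
qed

text \<open>The rearrangement is at least \<open>v\<close> on (0, \<kappa>). With the normalisation
  \<tau>/p the weight integrates there to exactly \<open>\<kappa> powr (\<tau> / p)\<close>.\<close>

lemma lorentz_norm_ge:
  fixes f :: "real ^ 'm \<Rightarrow> 'a::real_normed_vector"
  assumes p: "p > 0" and tau: "\<tau> > 0" and v: "v \<ge> 0" and k: "0 < \<kappa>" "\<kappa> \<le> 1"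
    and large: "\<And>y. 0 \<le> y \<Longrightarrow> y < v \<Longrightarrow> ennreal \<kappa> \<le> emeasure lebesgue {x. (\<forall>j. 0 \<le> x $ j \<and> x $ j < 1) \<and>
      norm (f ((2 * pi) *\<^sub>R x)) > y}"
  shows "ennreal (v * \<kappa> powr (1 / p)) \<le> lorentz_norm p \<tau> f"
proof -
  have *: "ennreal (v powr \<tau>) \<le> enn_powr (rearrangement f t) \<tau>" if t: "0 < t" "t < \<kappa>" for t
  proof -
    have "ennreal v \<le> rearrangement f t"
      using t k large by (intro rearrangement_ge) (meson ennreal_lessI less_le_trans)
    then show ?thesis
      using enn_powr_mono[of "ennreal v" "rearrangement f t" \<tau>] tau v by (simp add: enn_powr_ennreal)
  qed
  have "v * \<kappa> powr (1 / p) = (v powr \<tau> * \<kappa> powr (\<tau> / p)) powr (1 / \<tau>)"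
    using v k tau p by (simp add: powr_mult powr_powr)
  then have "ennreal (v * \<kappa> powr (1 / p)) = enn_powr (ennreal (v powr \<tau> * \<kappa> powr (\<tau> / p))) (1 / \<tau>)"
    by (simp add: enn_powr_ennreal)
  also have "\<dots> = enn_powr (ennreal (\<tau> / p) * (ennreal (v powr \<tau>) * ennreal (\<kappa> powr (\<tau> / p) / (\<tau> / p)))) (1 / \<tau>)"
    using p tau by (simp flip: ennreal_mult)
  also have "ennreal (v powr \<tau>) * ennreal (\<kappa> powr (\<tau> / p) / (\<tau> / p)) =
    (\<integral>\<^sup>+ t. ennreal (v powr \<tau>) * (ennreal (t powr (\<tau> / p - 1)) * indicator {0<..<\<kappa>} t) \<partial>lborel)"
    using nn_integral_powr_Ioo[of "\<tau> / p" \<kappa>] p tau k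
    by (subst nn_integral_cmult) auto
  also have "enn_powr (ennreal (\<tau> / p) * \<dots>) (1 / \<tau>) \<le> lorentz_norm p \<tau> f"
    unfolding lorentz_norm_def using k tau *
    by (intro enn_powr_mono mult_left_mono nn_integral_mono)
      (auto split: split_indicator intro!: mult_right_mono)
  finally show ?thesis .
qed

section \<open>Integrals of products of functions of one variable\<close>

lemma prod_Basis_vec:
  fixes F :: "real ^ 'm \<Rightarrow> 'b::comm_monoid_mult"
  shows "(\<Prod>b\<in>Basis. F b) = (\<Prod>j\<in>UNIV. F (axis j 1))"
proof -
  have "(Basis :: (real ^ 'm) set) = range (\<lambda>j. axis j 1)"
    by (auto simp: Basis_vec_def)
  moreover have "inj (\<lambda>j. axis j 1 :: real ^ 'm)"
    by (auto simp: inj_on_def axis_eq_axis)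
  ultimately show ?thesis
    using prod.reindex[of "\<lambda>j. axis j 1 :: real ^ 'm" UNIV F] by (simp add: comp_def)
qed

lemma nn_integral_lborel_vec_prod:
  fixes f :: "'m::finite \<Rightarrow> real \<Rightarrow> ennreal"
  assumes "\<And>j. f j \<in> borel_measurable borel"
  shows "(\<integral>\<^sup>+ x. (\<Prod>j\<in>UNIV. f j (x $ j)) \<partial>lborel) = (\<Prod>j\<in>UNIV. \<integral>\<^sup>+ y. f j y \<partial>lborel)"
proof -
  \<comment> \<open>\<open>THE\<close> inverts the bijection from coordinates to basis vectors, so
    that the family is indexed by \<open>Basis\<close> as in the product theorem for
    \<open>lborel\<close>.\<close>
  define F where "F b = f (THE j. b = axis j (1::real))" for b :: "real ^ 'm"
  have F: "F (axis j 1) = f j" for j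
    by (simp add: F_def axis_eq_axis)
  have "b \<in> Basis \<Longrightarrow> F b \<in> borel_measurable borel" for b
    by (auto simp: F_def assms)
  from nn_integral_lborel_prod[of F, OF this] show ?thesis
    by (simp add: prod_Basis_vec F inner_axis)
qed

lemma integral_lborel_vec_prod:
  fixes f :: "'m::finite \<Rightarrow> real \<Rightarrow> complex"
  assumes int: "\<And>j. integrable lborel (f j)"
  shows "(\<integral> x. (\<Prod>j\<in>UNIV. f j (x $ j)) \<partial>lborel) = (\<Prod>j\<in>UNIV. \<integral> y. f j y \<partial>lborel)"
proof -
  define F where "F b = f (THE j. b = axis j (1::real))" for b :: "real ^ 'm"
  have F: "F (axis j 1) = f j" for j
    by (simp add: F_def axis_eq_axis)
  have [measurable]: "f j \<in> borel_measurable borel" for j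
    using int[of j] by simp
  interpret product_sigma_finite "\<lambda>_::real ^ 'm. lborel :: real measure"
    by unfold_locales
  have meas: "(\<lambda>x. \<Prod>j\<in>UNIV. f j (x $ j)) \<in> borel_measurable (borel :: (real ^ 'm) measure)"
    by measurable
  have "(\<integral> x. (\<Prod>j\<in>UNIV. f j (x $ j)) \<partial>lborel) =
      (\<integral> x. (\<Prod>j\<in>UNIV. f j ((\<Sum>b\<in>Basis. x b *\<^sub>R b) $ j)) \<partial>(\<Pi>\<^sub>M b\<in>(Basis::(real ^ 'm) set). lborel))"
    by (subst lborel_eq, subst integral_distr) (use meas in measurable)
  also have "\<dots> = (\<integral> x. (\<Prod>b\<in>Basis. F b (x b)) \<partial>(\<Pi>\<^sub>M b\<in>(Basis::(real ^ 'm) set). lborel))"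
  proof (intro Bochner_Integration.integral_cong refl)
    fix x :: "real ^ 'm \<Rightarrow> real"
    have "(\<Sum>b\<in>Basis. x b *\<^sub>R b) $ j = x (axis j 1)" for j
      using inner_sum_left_Basis[of "axis j 1" x] by (simp add: cart_eq_inner_axis)
    then show "(\<Prod>j\<in>UNIV. f j ((\<Sum>b\<in>Basis. x b *\<^sub>R b) $ j)) = (\<Prod>b\<in>Basis. F b (x b))"
      by (simp add: prod_Basis_vec F)
  qed
  also have "\<dots> = (\<Prod>b\<in>Basis. \<integral> y. F b y \<partial>lborel)"
    by (rule product_integral_prod) (auto simp: F_def int)
  also have "\<dots> = (\<Prod>j\<in>UNIV. \<integral> y. f j y \<partial>lborel)"
    by (simp add: prod_Basis_vec F)
  finally show ?thesis .
qed

section \<open>Differences\<close>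

definition fdiff :: "real \<Rightarrow> (real \<Rightarrow> real) \<Rightarrow> real \<Rightarrow> real" where
  "fdiff h \<phi> y = \<phi> (y + h) - \<phi> y"

lemma funpow_fdiff_measurable [measurable]:
  assumes [measurable]: "\<phi> \<in> borel_measurable borel"
  shows "(fdiff h ^^ k) \<phi> \<in> borel_measurable borel"
proof (induction k)
  case (Suc k)
  note [measurable] = Suc
  have "(fdiff h ^^ Suc k) \<phi> = (\<lambda>y. (fdiff h ^^ k) \<phi> (y + h) - (fdiff h ^^ k) \<phi> y)"
    by (simp add: fdiff_def fun_eq_iff)
  then show ?case
    by simp
qed simp

lemma partial_diff_prod:
  "partial_diff i k h (\<lambda>x. \<Prod>j\<in>UNIV. \<psi> j (x $ j)) =
    (\<lambda>x. \<Prod>j\<in>UNIV. (\<psi>(i := (fdiff h ^^ k) (\<psi> i))) j (x $ j))"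
proof (induction k)
  case 0
  show ?case by (simp add: partial_diff_def)
next
  case (Suc k)
  have split: "(\<Prod>j\<in>UNIV. (\<psi>(i := g)) j (x $ j)) = g (x $ i) * (\<Prod>j\<in>UNIV - {i}. \<psi> j (x $ j))" for g x
    by (subst prod.remove[of _ i]) auto
  have shift: "(\<Prod>j\<in>UNIV - {i}. \<psi> j ((x + h *\<^sub>R axis i 1) $ j)) = (\<Prod>j\<in>UNIV - {i}. \<psi> j (x $ j))" for x
    by (intro prod.cong) (auto simp: axis_def)
  have "partial_diff i (Suc k) h (\<lambda>x. \<Prod>j\<in>UNIV. \<psi> j (x $ j)) =
      diff_step i h (\<lambda>x. \<Prod>j\<in>UNIV. (\<psi>(i := (fdiff h ^^ k) (\<psi> i))) j (x $ j))"
    using Suc by (simp add: partial_diff_def)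
  also have "\<dots> = (\<lambda>x. \<Prod>j\<in>UNIV. (\<psi>(i := (fdiff h ^^ Suc k) (\<psi> i))) j (x $ j))"
    unfolding diff_step_def split shift by (simp add: fdiff_def algebra_simps)
  finally show ?case .
qed

lemma mixed_diff_prod:
  "mixed_diff k h (\<lambda>x. \<Prod>j\<in>UNIV. \<psi> j (x $ j)) =
    (\<lambda>x. \<Prod>j\<in>UNIV. (fdiff (h $ j) ^^ (k $ j)) (\<psi> j) (x $ j))"
proof -
  interpret comp_fun_commute "\<lambda>j. partial_diff j (k $ j) (h $ j)"
    by (rule comp_fun_commute_partial_diff)
  \<comment> \<open>Generalised from \<open>UNIV\<close> to every set \<open>S\<close> of already
    processed coordinates, so that induction can insert one coordinate at a time.\<close>
  have "Finite_Set.fold (\<lambda>j. partial_diff j (k $ j) (h $ j)) (\<lambda>x. \<Prod>j\<in>UNIV. \<psi> j (x $ j)) S =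
      (\<lambda>x. \<Prod>j\<in>UNIV. (if j \<in> S then (fdiff (h $ j) ^^ (k $ j)) (\<psi> j) else \<psi> j) (x $ j))" for S
  proof (induction S rule: finite_induct[OF finite])
    case 1
    show ?case by simp
  next
    case (2 i S)
    have "(\<lambda>j. if j \<in> S then (fdiff (h $ j) ^^ (k $ j)) (\<psi> j) else \<psi> j)
        (i := (fdiff (h $ i) ^^ (k $ i)) (\<psi> i)) =
      (\<lambda>j. if j \<in> insert i S then (fdiff (h $ j) ^^ (k $ j)) (\<psi> j) else \<psi> j)"
      by auto
    with 2 partial_diff_prod[of i "k $ i" "h $ i" "\<lambda>j. if j \<in> S then (fdiff (h $ j) ^^ (k $ j)) (\<psi> j) else \<psi> j"]
    show ?case
      by (simp add: fold_insert)
  qed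
  from this[of UNIV] show ?thesis
    by (simp add: mixed_diff_def)
qed

text \<open>Up to a phase, a cosine is an eigenfunction of the difference. The quarter turn pi/2
  rewrites the sine of the sum-to-product formula as a cosine, which lets the identity
  iterate.\<close>

lemma funpow_fdiff_cos:
  "(fdiff h ^^ k) (\<lambda>y. cos (N * y + \<phi>)) =
    (\<lambda>y. (2 * sin (N * h / 2)) ^ k * cos (N * y + (\<phi> + real k * (N * h / 2 + pi / 2))))"
proof (induction k)
  case (Suc k)
  have *: "cos (x + N * h) - cos x = 2 * sin (N * h / 2) * cos (x + (N * h / 2 + pi / 2))" for x
  proof -
    have "cos (x + (N * h / 2 + pi / 2)) = - sin (x + N * h / 2)"
      by (simp add: cos_add sin_add)
    moreover have "cos (x + N * h) - cos x = - 2 * sin (x + N * h / 2) * sin (N * h / 2)"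
      using cos_diff_cos[of "x + N * h" x] by (simp add: add_divide_distrib sin_minus algebra_simps)
    ultimately show ?thesis
      by simp
  qed
  show ?case
  proof
    fix y
    define x where "x = N * y + (\<phi> + real k * (N * h / 2 + pi / 2))"
    have "N * (y + h) + (\<phi> + real k * (N * h / 2 + pi / 2)) = x + N * h"
      by (simp add: x_def algebra_simps)
    then have "(fdiff h ^^ Suc k) (\<lambda>y. cos (N * y + \<phi>)) y =
        (2 * sin (N * h / 2)) ^ k * (cos (x + N * h) - cos x)"
      by (simp only: funpow.simps comp_apply Suc fdiff_def right_diff_distrib x_def[symmetric])
    also have "\<dots> = (2 * sin (N * h / 2)) ^ Suc k * cos (x + (N * h / 2 + pi / 2))"
      by (simp add: *)
    also have "x + (N * h / 2 + pi / 2) = N * y + (\<phi> + real (Suc k) * (N * h / 2 + pi / 2))"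
      by (simp add: x_def algebra_simps add_divide_distrib)
    finally show "(fdiff h ^^ Suc k) (\<lambda>y. cos (N * y + \<phi>)) y =
      (2 * sin (N * h / 2)) ^ Suc k * cos (N * y + (\<phi> + real (Suc k) * (N * h / 2 + pi / 2)))" .
  qed
qed simp

lemma funpow_fdiff_sum:
  "(fdiff h ^^ k) (\<lambda>y. \<Sum>n\<in>A. c n * f n y) = (\<lambda>y. \<Sum>n\<in>A. c n * (fdiff h ^^ k) (f n) y)"
  by (induction k) (auto simp: fdiff_def fun_eq_iff right_diff_distrib sum_subtractf)

lemma funpow_fdiff_lacunary_sum:
  "(fdiff h ^^ k) (lacunary_sum c \<phi> M) =
    lacunary_sum (\<lambda>n. c n * (2 * sin (2 ^ n * h / 2)) ^ k) (\<lambda>n. \<phi> n + real k * (2 ^ n * h / 2 + pi / 2)) M"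
  unfolding lacunary_sum_def [abs_def] funpow_fdiff_sum funpow_fdiff_cos by (simp add: mult.assoc)

lemma lacunary_sum_shift:
  "lacunary_sum c \<phi> M (y + d) = lacunary_sum c (\<lambda>n. \<phi> n + 2 ^ n * d) M y"
  by (simp add: lacunary_sum_def algebra_simps)

section \<open>Passage to almost everywhere limits\<close>

lemma AE_tendsto_funpow_fdiff:
  assumes "\<And>d. AE x in lborel. x \<in> {0..<1} \<longrightarrow> (\<lambda>i. S i (2 * pi * x + d)) \<longlonglongrightarrow> G (2 * pi * x + d)"
  shows "AE x in lborel. x \<in> {0..<1} \<longrightarrow>
    (\<lambda>i. (fdiff h ^^ k) (S i) (2 * pi * x + d)) \<longlonglongrightarrow> (fdiff h ^^ k) G (2 * pi * x + d)"
proof (induction k arbitrary: d)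
  case 0
  then show ?case using assms by simp
next
  case (Suc k)
  \<comment> \<open>One more difference also evaluates at the offset d + h, which is why the claim
    is proved for all offsets at once. Each step discards just two null sets.\<close>
  show ?case
    using Suc[of d] Suc[of "d + h"] by eventually_elim (auto simp: fdiff_def add.assoc intro!: tendsto_diff)
qed

text \<open>Fatou's lemma, applied to the exponentials instead of the functions themselves.\<close>

lemma nn_integral_exp_limit:
  fixes S :: "nat \<Rightarrow> real \<Rightarrow> real"
  assumes [measurable]: "\<And>i. S i \<in> borel_measurable borel"
    and lim: "AE x in lborel. x \<in> {0..<1} \<longrightarrow> (\<lambda>i. S i (2 * pi * x)) \<longlonglongrightarrow> G (2 * pi * x)"
    and bound: "\<And>i. (\<integral>\<^sup>+ x \<in> {0..<1}. ennreal (exp (\<bar>S i (2 * pi * x)\<bar> / \<sigma>)) \<partial>lborel) \<le> C"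
  shows "(\<integral>\<^sup>+ x \<in> {0..<1}. ennreal (exp (\<bar>G (2 * pi * x)\<bar> / \<sigma>)) \<partial>lborel) \<le> C"
proof -
  have "(\<integral>\<^sup>+ x \<in> {0..<1}. ennreal (exp (\<bar>G (2 * pi * x)\<bar> / \<sigma>)) \<partial>lborel)
      = (\<integral>\<^sup>+ x. liminf (\<lambda>i. ennreal (exp (\<bar>S i (2 * pi * x)\<bar> / \<sigma>)) * indicator {0..<1} x) \<partial>lborel)"
  proof (rule nn_integral_cong_AE, use lim in eventually_elim)
    fix x :: real
    assume lim: "x \<in> {0..<1} \<longrightarrow> (\<lambda>i. S i (2 * pi * x)) \<longlonglongrightarrow> G (2 * pi * x)"
    have "(\<lambda>i. ennreal (exp (\<bar>S i (2 * pi * x)\<bar> / \<sigma>)) * indicator {0..<1} x)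
      \<longlonglongrightarrow> ennreal (exp (\<bar>G (2 * pi * x)\<bar> / \<sigma>)) * indicator {0..<1} x"
    proof (cases "x \<in> {0..<1}")
      case True
      with lim have "(\<lambda>i. exp (\<bar>S i (2 * pi * x)\<bar> * inverse \<sigma>)) \<longlonglongrightarrow> exp (\<bar>G (2 * pi * x)\<bar> * inverse \<sigma>)"
        by (intro tendsto_intros) auto
      with True show ?thesis
        by (simp add: divide_inverse)
    qed simp
    from lim_imp_Liminf[OF _ this]
    show "ennreal (exp (\<bar>G (2 * pi * x)\<bar> / \<sigma>)) * indicator {0..<1} x =
      liminf (\<lambda>i. ennreal (exp (\<bar>S i (2 * pi * x)\<bar> / \<sigma>)) * indicator {0..<1} x)"
      by simp
  qed
  also have "\<dots> \<le> liminf (\<lambda>i. \<integral>\<^sup>+ x \<in> {0..<1}. ennreal (exp (\<bar>S i (2 * pi * x)\<bar> / \<sigma>)) \<partial>lborel)"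
    by (rule nn_integral_liminf) simp
  also have "\<dots> \<le> liminf (\<lambda>i. C)"
    by (intro Liminf_mono always_eventually allI bound)
  finally show ?thesis
    by (simp add: Liminf_const)
qed

section \<open>Coefficients of the lacunary series\<close>

definition lac_coeff :: "real \<Rightarrow> nat \<Rightarrow> real" where
  "lac_coeff \<eta> n = sqrt ((real n + 1) powr (- 2 * \<eta>) - (real n + 2) powr (- 2 * \<eta>))"

lemma lac_coeff_square:
  assumes "\<eta> > 0"
  shows "(lac_coeff \<eta> n)\<^sup>2 = (real n + 1) powr (- 2 * \<eta>) - (real (Suc n) + 1) powr (- 2 * \<eta>)"
proof -
  have "(real n + 2) powr (- 2 * \<eta>) \<le> (real n + 1) powr (- 2 * \<eta>)"
    using assms by (intro powr_mono2') auto
  then show ?thesis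
    by (simp add: lac_coeff_def add.commute)
qed

text \<open>The squares are differences of consecutive values of a power, so the sum telescopes and
  no comparison with an integral is needed.\<close>

lemma sum_lac_coeff_square_le:
  assumes "\<eta> > 0"
  shows "(\<Sum>n\<in>{N..<M}. (lac_coeff \<eta> n)\<^sup>2) \<le> (real N + 1) powr (- 2 * \<eta>)"
proof (cases "N \<le> M")
  case True
  have "(\<Sum>n\<in>{N..<M}. (lac_coeff \<eta> n)\<^sup>2) =
      - (\<Sum>n\<in>{N..<M}. (real (Suc n) + 1) powr (- 2 * \<eta>) - (real n + 1) powr (- 2 * \<eta>))"
    unfolding lac_coeff_square[OF assms] sum_negf[symmetric] by simp
  also have "\<dots> = (real N + 1) powr (- 2 * \<eta>) - (real M + 1) powr (- 2 * \<eta>)"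
    by (subst sum_Suc_diff'[OF True, of "\<lambda>n. (real n + 1) powr (- 2 * \<eta>)"]) simp
  finally show ?thesis
    by simp
qed simp

text \<open>Mean value theorem for x powr (-2\<eta>) between n + 1 and n + 2. The derivative
  decreases in modulus, so its value at n + 2 is a lower bound, and the square root halves the
  exponent -2\<eta> - 1.\<close>

lemma lac_coeff_ge:
  assumes "\<eta> > 0"
  shows "sqrt (2 * \<eta>) * (real n + 2) powr (- \<eta> - 1/2) \<le> lac_coeff \<eta> n"
proof -
  have "\<exists>z. real n + 1 < z \<and> z < real n + 2 \<and>
    (real n + 2) powr (- 2 * \<eta>) - (real n + 1) powr (- 2 * \<eta>) =
      (real n + 2 - (real n + 1)) * (- 2 * \<eta> * z powr (- 2 * \<eta> - 1))"
    by (rule MVT2) (auto intro!: derivative_eq_intros)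
  then obtain z where z: "real n + 1 < z" "z < real n + 2"
    and eq: "(real n + 1) powr (- 2 * \<eta>) - (real n + 2) powr (- 2 * \<eta>) = 2 * \<eta> * z powr (- 2 * \<eta> - 1)"
    by (auto simp: algebra_simps)
  have "(real n + 2) powr (- 2 * \<eta> - 1) \<le> z powr (- 2 * \<eta> - 1)"
    using z assms by (intro powr_mono2') auto
  then have "2 * \<eta> * (real n + 2) powr (- 2 * \<eta> - 1) \<le> 2 * \<eta> * z powr (- 2 * \<eta> - 1)"
    using assms by simp
  moreover have "(sqrt (2 * \<eta>) * (real n + 2) powr (- \<eta> - 1/2))\<^sup>2 = 2 * \<eta> * (real n + 2) powr (- 2 * \<eta> - 1)"
    using assms by (simp add: power_mult_distrib powr_power)
  ultimately show ?thesis
    unfolding lac_coeff_def eq by (intro real_le_rsqrt) simp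
qed

lemma lac_coeff_nonneg: "\<eta> > 0 \<Longrightarrow> 0 \<le> lac_coeff \<eta> n"
  using lac_coeff_ge[of \<eta> n] by (smt (verit) mult_nonneg_nonneg powr_ge_zero real_sqrt_ge_zero)

section \<open>The lacunary series\<close>

text \<open>The cuts are at 2^i - 1, not 2^i, because the tail of the square sum from N on is
  bounded by a power of N + 1. This makes the block bounds exactly geometric, and block 0 starts at
  the empty sum.\<close>

definition lac_block :: "real \<Rightarrow> nat \<Rightarrow> real \<Rightarrow> real" where
  "lac_block \<eta> i y = lacunary_sum (lac_coeff \<eta>) (\<lambda>_. 0) (2 ^ Suc i - 1) y
    - lacunary_sum (lac_coeff \<eta>) (\<lambda>_. 0) (2 ^ i - 1) y"

text \<open>
  The coefficients need not be summable. Grouped into blocks, the series converges absolutely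
  almost everywhere, since the \<open>L\<^sup>1\<close> norms of the blocks decay geometrically.
\<close>

definition lac_series :: "real \<Rightarrow> real \<Rightarrow> real" where
  "lac_series \<eta> y = (\<Sum>i. lac_block \<eta> i y)"

lemma lac_block_measurable [measurable]: "lac_block \<eta> i \<in> borel_measurable borel"
  unfolding lac_block_def [abs_def] by measurable

lemma lac_series_measurable [measurable]: "lac_series \<eta> \<in> borel_measurable borel"
  unfolding lac_series_def [abs_def] by measurable

text \<open>Valid at every point, even where the series diverges and \<open>suminf\<close> has an
  unspecified value, because the block values at the two points are identical. Membership in
  \<open>lorentz_space\<close> asks for periodicity everywhere.\<close>

lemma lac_series_periodic: "lac_series \<eta> (y + 2 * pi) = lac_series \<eta> y"
  unfolding lac_series_def lac_block_def lacunary_sum_periodic ..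

lemma sum_lac_block:
  "(\<Sum>i<I. lac_block \<eta> i y) = lacunary_sum (lac_coeff \<eta>) (\<lambda>_. 0) (2 ^ I - 1) y"
proof -
  have "(\<Sum>i<I. lac_block \<eta> i y) = lacunary_sum (lac_coeff \<eta>) (\<lambda>_. 0) (2 ^ I - 1) y
      - lacunary_sum (lac_coeff \<eta>) (\<lambda>_. 0) (2 ^ 0 - 1) y"
    unfolding lac_block_def by (rule sum_lessThan_telescope)
  then show ?thesis
    by (simp add: lacunary_sum_def)
qed

lemma lacunary_sum_diff:
  assumes "N \<le> M"
  shows "lacunary_sum c \<phi> M y - lacunary_sum c \<phi> N y =
    lacunary_sum (\<lambda>n. if n < N then 0 else c n) \<phi> M y"
proof -
  have "lacunary_sum c \<phi> M y - lacunary_sum c \<phi> N y = (\<Sum>n\<in>{N..<M}. c n * cos (2 ^ n * y + \<phi> n))"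
    using assms by (simp add: lacunary_sum_def lessThan_atLeast0 sum_diff_nat_ivl)
  also have "\<dots> = lacunary_sum (\<lambda>n. if n < N then 0 else c n) \<phi> M y"
    unfolding lacunary_sum_def by (rule sum.mono_neutral_cong_left) auto
  finally show ?thesis .
qed

text \<open>The inequality |z| \<le> \<sigma> exp (|z|/\<sigma>), with \<sigma> bounding the l2 norm
  of the block, turns the exponential moment into an L1 bound. The offset \<open>d\<close> is
  absorbed into the phases.\<close>

lemma nn_integral_lac_block:
  fixes d :: real
  assumes "\<eta> > 0"
  shows "(\<integral>\<^sup>+ x \<in> {0..<1}. ennreal \<bar>lac_block \<eta> i (2 * pi * x + d)\<bar> \<partial>lborel) \<le> ennreal (4 * (2 powr (- \<eta>)) ^ i)"
proof -
  \<comment> \<open>Setting the low coefficients to zero presents the block as a lacunary sum, to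
    which the moment bound applies.\<close>
  define c where "c n = (if n < 2 ^ i - 1 then 0 else lac_coeff \<eta> n)" for n
  define S where "S = lacunary_sum c (\<lambda>n. 2 ^ n * d) (2 ^ Suc i - 1)"
  define \<sigma> where "\<sigma> = (2 powr (- \<eta>)) ^ i"
  have "\<sigma> > 0" by (simp add: \<sigma>_def)
  have S: "lac_block \<eta> i (y + d) = S y" for y
    unfolding lac_block_def
    by (subst lacunary_sum_diff) (auto simp: S_def c_def [abs_def] lacunary_sum_shift diff_le_mono)
  have [measurable]: "S \<in> borel_measurable borel"
    by (simp add: S_def)
  have "(\<Sum>n<2 ^ Suc i - 1. (c n)\<^sup>2) = (\<Sum>n\<in>{2 ^ i - 1..<2 ^ Suc i - 1}. (lac_coeff \<eta> n)\<^sup>2)"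
    unfolding c_def by (rule sum.mono_neutral_cong_right) auto
  also have "\<dots> \<le> (real (2 ^ i - 1) + 1) powr (- 2 * \<eta>)"
    by (rule sum_lac_coeff_square_le) fact
  also have "\<dots> = \<sigma>\<^sup>2"
    by (simp add: \<sigma>_def of_nat_diff powr_realpow[symmetric] powr_powr power2_eq_square powr_add[symmetric] mult_ac)
  finally have *: "(\<integral>\<^sup>+ x \<in> {0..<1}. ennreal (exp (\<bar>S (2 * pi * x)\<bar> / \<sigma>)) \<partial>lborel) \<le> 4"
    unfolding S_def using \<open>\<sigma> > 0\<close> by (rule nn_integral_exp_lacunary_sum)
  have "\<bar>z\<bar> \<le> \<sigma> * exp (\<bar>z\<bar> / \<sigma>)" for z
    using exp_ge_add_one_self[of "\<bar>z\<bar> / \<sigma>"] \<open>\<sigma> > 0\<close> by (simp add: field_simps)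
  then have "ennreal \<bar>z\<bar> \<le> ennreal \<sigma> * ennreal (exp (\<bar>z\<bar> / \<sigma>))" for z
    using \<open>\<sigma> > 0\<close> by (simp flip: ennreal_mult add: ennreal_leI)
  then have "(\<integral>\<^sup>+ x \<in> {0..<1}. ennreal \<bar>S (2 * pi * x)\<bar> \<partial>lborel) \<le>
      (\<integral>\<^sup>+ x. ennreal \<sigma> * (ennreal (exp (\<bar>S (2 * pi * x)\<bar> / \<sigma>)) * indicator {0..<1} x) \<partial>lborel)"
    by (intro nn_integral_mono) (auto split: split_indicator)
  also have "\<dots> \<le> ennreal \<sigma> * 4"
    using * by (subst nn_integral_cmult) (auto intro!: mult_left_mono)
  also have "\<dots> = ennreal (4 * \<sigma>)"
    using \<open>\<sigma> > 0\<close> by (simp add: ennreal_mult mult.commute)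
  finally show ?thesis
    unfolding S \<sigma>_def .
qed

text \<open>By monotone convergence the integral of the sum is bounded by a convergent geometric
  series, so the sum is finite almost everywhere.\<close>

lemma AE_summable_geometric:
  fixes P :: "nat \<Rightarrow> real \<Rightarrow> real"
  assumes [measurable]: "\<And>i. P i \<in> borel_measurable borel" "A \<in> sets borel"
    and P_nonneg: "\<And>i x. 0 \<le> P i x" and r: "0 \<le> r" "r < 1" and C: "0 \<le> C"
    and bound: "\<And>i. (\<integral>\<^sup>+ x \<in> A. ennreal (P i x) \<partial>lborel) \<le> ennreal (C * r ^ i)"
  shows "AE x in lborel. x \<in> A \<longrightarrow> summable (\<lambda>i. P i x)"
proof -
  have "(\<integral>\<^sup>+ x. (\<Sum>i. ennreal (P i x) * indicator A x) \<partial>lborel)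
    = (\<Sum>i. \<integral>\<^sup>+ x \<in> A. ennreal (P i x) \<partial>lborel)"
    by (rule nn_integral_suminf) simp
  also have "\<dots> \<le> (\<Sum>i. ennreal (C * r ^ i))"
    by (intro suminf_le bound) auto
  also have "\<dots> = ennreal (\<Sum>i. C * r ^ i)"
    using r C by (intro suminf_ennreal2 summable_mult summable_geometric) auto
  finally have "(\<integral>\<^sup>+ x. (\<Sum>i. ennreal (P i x) * indicator A x) \<partial>lborel) \<noteq> \<infinity>"
    by (auto simp: top_unique)
  then have "AE x in lborel. (\<Sum>i. ennreal (P i x) * indicator A x) \<noteq> \<infinity>"
    by (intro nn_integral_PInf_AE) auto
  then show ?thesis
  proof eventually_elim
    fix x assume "(\<Sum>i. ennreal (P i x) * indicator A x) \<noteq> \<infinity>"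
    then show "x \<in> A \<longrightarrow> summable (\<lambda>i. P i x)"
      using summable_suminf_not_top[of "\<lambda>i. P i x", OF P_nonneg] by auto
  qed
qed

lemma AE_summable_lac_block:
  fixes d :: real
  assumes "\<eta> > 0"
  shows "AE x in lborel. x \<in> {0..<1} \<longrightarrow> summable (\<lambda>i. \<bar>lac_block \<eta> i (2 * pi * x + d)\<bar>)"
  by (rule AE_summable_geometric[of _ _ "2 powr (- \<eta>)" 4])
    (use assms nn_integral_lac_block in \<open>auto simp: powr_less_one\<close>)

lemma AE_tendsto_lac_series:
  fixes d :: real
  assumes "\<eta> > 0"
  shows "AE x in lborel. x \<in> {0..<1} \<longrightarrow>
    (\<lambda>I. lacunary_sum (lac_coeff \<eta>) (\<lambda>_. 0) (2 ^ I - 1) (2 * pi * x + d)) \<longlonglongrightarrow> lac_series \<eta> (2 * pi * x + d)"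
  using AE_summable_lac_block[OF assms, of d]
proof eventually_elim
  case (elim x)
  then show ?case
    using summable_sums[OF summable_rabs_cancel, of "\<lambda>i. lac_block \<eta> i (2 * pi * x + d)"]
    unfolding sums_def sum_lac_block lac_series_def by simp
qed

text \<open>The first summand pays for the low frequencies, through \<open>two_powr_minus_le\<close>
  with e = 2\<eta>. The second pays for the tail, where the cutoff N + 1 is replaced by L/2.\<close>

definition mod_const :: "real \<Rightarrow> real" where
  "mod_const \<eta> = 4 * (2 * \<eta> / ln 2) powr (2 * \<eta>) + 2 powr (2 * \<eta>)"

lemma mod_const_pos: "mod_const \<eta> > 0"
  by (simp add: mod_const_def add_nonneg_pos)

lemma powr_square: "(x powr a)\<^sup>2 = x powr (2 * a)" for x a :: real
  by (simp add: power2_eq_square flip: powr_add)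

text \<open>This is x \<le> exp x at x = L ln 2 / e, raised to the power e.\<close>

lemma two_powr_minus_le:
  assumes "e > 0" "L \<ge> 1"
  shows "2 powr (- L) \<le> (e / ln 2) powr e * L powr (- e :: real)"
proof -
  have "L * ln 2 / e \<le> exp (L * ln 2 / e)"
    using exp_ge_add_one_self[of "L * ln 2 / e"] by linarith
  then have "(L * ln 2 / e) powr e \<le> exp (L * ln 2 / e) powr e"
    using assms by (intro powr_mono2) auto
  also have "\<dots> = 2 powr L"
    using assms by (simp add: exp_powr_real powr_def mult.commute)
  finally have le: "(L * ln 2 / e) powr e \<le> 2 powr L" .
  have "L = (e / ln 2) * (L * ln 2 / e)"
    using assms by simp
  then have "L powr e = (e / ln 2) powr e * (L * ln 2 / e) powr e"
    using assms by (metis powr_mult)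
  with le have "L powr e \<le> (e / ln 2) powr e * 2 powr L"
    by (simp add: mult_left_mono)
  moreover have "x \<le> A * y \<Longrightarrow> x > 0 \<Longrightarrow> y > 0 \<Longrightarrow> 1 / y \<le> A * (1 / x)" for x y A :: real
    by (simp add: field_simps)
  ultimately show ?thesis
    using assms unfolding powr_minus_divide by simp
qed

text \<open>Only one of the \<open>k\<close> sine factors is used for smallness, and the others are
  bounded by 1. Against logarithmic weights first order is enough, so every k \<ge> 1 is treated
  alike.\<close>

lemma abs_two_sin_power_le:
  assumes "k \<ge> 1"
  shows "\<bar>(2 * sin (x / 2)) ^ k\<bar> \<le> 2 ^ k * min 1 \<bar>x :: real\<bar>"
proof -
  obtain k' where k: "k = Suc k'" using assms by (cases k) auto
  have "\<bar>sin (x / 2)\<bar> \<le> \<bar>x / 2\<bar>" "\<bar>sin (x / 2)\<bar> \<le> 1"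
    using abs_sin_x_le_abs_x[of "x / 2"] by auto
  then have "\<bar>sin (x / 2)\<bar> \<le> min 1 \<bar>x\<bar>" by auto
  moreover have "\<bar>sin (x / 2)\<bar> ^ k' \<le> 1"
    by (intro power_le_one) auto
  ultimately have "\<bar>sin (x / 2)\<bar> * \<bar>sin (x / 2)\<bar> ^ k' \<le> min 1 \<bar>x\<bar> * 1"
    by (intro mult_mono) auto
  then show ?thesis
    by (simp add: k abs_mult power_mult_distrib power_abs)
qed

text \<open>For the cosine factors. Their decay is linear in \<open>t\<close> and is deliberately
  weakened to the logarithmic form of the lacunary factor, so that all coordinates are estimated by
  the same expression.\<close>

lemma abs_two_sin_power_le_mod_const:
  assumes "k \<ge> 1" "\<eta> > 0" "0 < t" "t \<le> 1" "\<bar>h\<bar> \<le> t"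
  shows "\<bar>(2 * sin (h / 2)) ^ k\<bar> \<le> 2 ^ k * sqrt (mod_const \<eta>) * (1 - log 2 t) powr (- \<eta>)"
proof -
  define L where "L = 1 - log 2 t"
  have L: "L \<ge> 1" using assms by (simp add: L_def)
  have t: "t = 2 powr (1 - L)" using assms by (simp add: L_def)
  have "t\<^sup>2 = 4 * (2 powr (- L) * 2 powr (- L))"
    unfolding t by (simp add: powr_diff power2_eq_square powr_minus_divide)
  also have "\<dots> \<le> 4 * (2 powr (- L) * 1)"
    using powr_mono[of "- L" 0 2] L by (intro mult_left_mono) auto
  also have "\<dots> \<le> 4 * ((2 * \<eta> / ln 2) powr (2 * \<eta>) * L powr (- (2 * \<eta>)))"
    using two_powr_minus_le[of "2 * \<eta>" L] L assms by simp
  also have "\<dots> \<le> mod_const \<eta> * L powr (- (2 * \<eta>))"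
    by (simp add: mod_const_def algebra_simps)
  also have "\<dots> = (sqrt (mod_const \<eta>) * L powr (- \<eta>))\<^sup>2"
    using mod_const_pos[of \<eta>] by (simp add: power_mult_distrib powr_square)
  finally have "t \<le> sqrt (mod_const \<eta>) * L powr (- \<eta>)"
    using mod_const_pos[of \<eta>] by (auto dest!: power2_le_imp_le)
  then have "min 1 \<bar>h\<bar> \<le> sqrt (mod_const \<eta>) * L powr (- \<eta>)"
    using assms by linarith
  then have "2 ^ k * min 1 \<bar>h\<bar> \<le> 2 ^ k * (sqrt (mod_const \<eta>) * L powr (- \<eta>))"
    by (rule mult_left_mono) simp
  with abs_two_sin_power_le[OF assms(1), of h]
  have "\<bar>(2 * sin (h / 2)) ^ k\<bar> \<le> 2 ^ k * (sqrt (mod_const \<eta>) * L powr (- \<eta>))"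
    by (rule order_trans)
  then show ?thesis
    by (simp only: L_def mult.assoc)
qed

text \<open>
  Frequencies up to about \<open>t powr (-1/2)\<close> are damped by the difference, the others
  contribute the tail of \<open>\<Sum>n. (lac_coeff \<eta> n)\<^sup>2\<close>.
\<close>

lemma sum_lac_coeff_diff_le:
  assumes "k \<ge> 1" "\<eta> > 0" "0 < t" "t \<le> 1" "\<bar>h\<bar> \<le> t"
  shows "(\<Sum>n<M. (lac_coeff \<eta> n * (2 * sin (2 ^ n * h / 2)) ^ k)\<^sup>2)
    \<le> (2 ^ k * sqrt (mod_const \<eta>) * (1 - log 2 t) powr (- \<eta>))\<^sup>2"
proof -
  define L where "L = 1 - log 2 t"
  have L: "L \<ge> 1" using assms by (simp add: L_def)
  have t: "t = 2 powr (1 - L)" using assms by (simp add: L_def)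
  \<comment> \<open>The cutoff frequency 2^N is about t powr (-1/2), which serves both sides. Below
    it, |2^n h| is at most 2 powr (1 - L/2), and N + 1 \<ge> L/2 keeps the tail of order L powr
    (-2\<eta>).\<close>
  define N where "N = nat \<lfloor>L / 2\<rfloor>"
  have N: "real N \<le> L / 2" "L / 2 \<le> real N + 1"
    using L of_int_floor_le[of "L / 2"] real_of_int_floor_add_one_ge[of "L / 2"] by (auto simp: N_def)
  let ?a = "lac_coeff \<eta>"
  have bound: "(?a n * (2 * sin (2 ^ n * h / 2)) ^ k)\<^sup>2 \<le>
      4 ^ k * (4 * 2 powr (- L) * (?a n)\<^sup>2 + (if N \<le> n then (?a n)\<^sup>2 else 0))" for n
  proof -
    have "((2 * sin (2 ^ n * h / 2)) ^ k)\<^sup>2 \<le> (2 ^ k * min 1 \<bar>2 ^ n * h\<bar>)\<^sup>2"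
      using power_mono[OF abs_two_sin_power_le[OF assms(1), of "2 ^ n * h"], of 2] by simp
    also have "\<dots> = 4 ^ k * (min 1 \<bar>2 ^ n * h\<bar>)\<^sup>2"
      by (simp add: power_mult_distrib power2_eq_square)
        (simp add: power_mult_distrib[symmetric])
    also have "\<dots> \<le> 4 ^ k * (4 * 2 powr (- L) + (if N \<le> n then 1 else 0))"
    proof (intro mult_left_mono)
      show "(min 1 \<bar>2 ^ n * h\<bar>)\<^sup>2 \<le> 4 * 2 powr (- L) + (if N \<le> n then 1 else 0)"
      proof (cases "N \<le> n")
        case True
        then show ?thesis
          by (auto intro!: add_increasing power_le_one)
      next
        case False
        have "\<bar>2 ^ n * h\<bar> = 2 ^ n * \<bar>h\<bar>"
          by (simp add: abs_mult)
        also have "\<dots> \<le> 2 ^ N * t"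
          using False assms by (intro mult_mono power_increasing) auto
        also have "\<dots> = 2 powr (real N + (1 - L))"
          unfolding t by (simp add: powr_realpow powr_add)
        also have "\<dots> \<le> 2 powr (1 - L / 2)"
          using N by simp
        finally have "(min 1 \<bar>2 ^ n * h\<bar>)\<^sup>2 \<le> (2 powr (1 - L / 2))\<^sup>2"
          by (intro power_mono) auto
        also have "\<dots> = 4 * 2 powr (- L)"
          unfolding powr_square by (simp add: right_diff_distrib powr_diff powr_minus_divide)
        finally show ?thesis
          using False by simp
      qed
    qed simp
    finally have "(?a n)\<^sup>2 * ((2 * sin (2 ^ n * h / 2)) ^ k)\<^sup>2 \<le>
        (?a n)\<^sup>2 * (4 ^ k * (4 * 2 powr (- L) + (if N \<le> n then 1 else 0)))"
      by (rule mult_left_mono) simp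
    also have "\<dots> = 4 ^ k * (4 * 2 powr (- L) * (?a n)\<^sup>2 + (if N \<le> n then (?a n)\<^sup>2 else 0))"
      by (cases "N \<le> n") (simp_all add: algebra_simps)
    finally show ?thesis
      by (simp only: power_mult_distrib[of "?a n"])
  qed
  have "(\<Sum>n<M. (?a n * (2 * sin (2 ^ n * h / 2)) ^ k)\<^sup>2) \<le>
      (\<Sum>n<M. 4 ^ k * (4 * 2 powr (- L) * (?a n)\<^sup>2 + (if N \<le> n then (?a n)\<^sup>2 else 0)))"
    by (intro sum_mono bound)
  also have "\<dots> = 4 ^ k * (4 * 2 powr (- L) * (\<Sum>n<M. (?a n)\<^sup>2) + (\<Sum>n<M. if N \<le> n then (?a n)\<^sup>2 else 0))"
    by (simp only: sum_distrib_left[symmetric] sum.distrib)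
  also have "(\<Sum>n<M. if N \<le> n then (?a n)\<^sup>2 else 0) = (\<Sum>n\<in>{N..<M}. (?a n)\<^sup>2)"
    by (rule sum.mono_neutral_cong_right) auto
  also have "4 ^ k * (4 * 2 powr (- L) * (\<Sum>n<M. (?a n)\<^sup>2) + \<dots>) \<le>
      4 ^ k * (4 * ((2 * \<eta> / ln 2) powr (2 * \<eta>) * L powr (- (2 * \<eta>))) * 1 + 2 powr (2 * \<eta>) * L powr (- (2 * \<eta>)))"
  proof (intro mult_left_mono add_mono mult_mono)
    show "2 powr (- L) \<le> (2 * \<eta> / ln 2) powr (2 * \<eta>) * L powr (- (2 * \<eta>))"
      using two_powr_minus_le[of "2 * \<eta>" L] L assms by simp
    show "(\<Sum>n<M. (?a n)\<^sup>2) \<le> 1"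
      using sum_lac_coeff_square_le[OF assms(2), of 0 M] by (simp add: lessThan_atLeast0)
    have "(\<Sum>n\<in>{N..<M}. (?a n)\<^sup>2) \<le> (real N + 1) powr (- 2 * \<eta>)"
      by (rule sum_lac_coeff_square_le) fact
    also have "\<dots> \<le> (L / 2) powr (- 2 * \<eta>)"
      using N L assms by (intro powr_mono2') auto
    also have "\<dots> = 2 powr (2 * \<eta>) * L powr (- (2 * \<eta>))"
      using L by (simp add: powr_divide powr_minus field_simps)
    finally show "(\<Sum>n\<in>{N..<M}. (?a n)\<^sup>2) \<le> 2 powr (2 * \<eta>) * L powr (- (2 * \<eta>))" .
  qed (auto intro!: sum_nonneg)
  also have "\<dots> = 4 ^ k * (mod_const \<eta> * L powr (- (2 * \<eta>)))"
    by (simp add: mod_const_def algebra_simps)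
  also have "\<dots> = (2 ^ k * sqrt (mod_const \<eta>) * L powr (- \<eta>))\<^sup>2"
  proof -
    have "(2 ^ k)\<^sup>2 = (4 ^ k :: real)"
      by (simp add: power2_eq_square flip: power_mult_distrib)
    then show ?thesis
      using mod_const_pos[of \<eta>] by (simp add: power_mult_distrib powr_square)
  qed
  finally show ?thesis
    by (simp add: L_def)
qed

text \<open>The square sums of the differenced partial sums are bounded independently of their
  length, so the same scale survives in the limit.\<close>

lemma nn_integral_exp_fdiff_lac_series:
  assumes "k \<ge> 1" "\<eta> > 0" "0 < t" "t \<le> 1" "\<bar>h\<bar> \<le> t"
  shows "(\<integral>\<^sup>+ x \<in> {0..<1}. ennreal (exp (\<bar>(fdiff h ^^ k) (lac_series \<eta>) (2 * pi * x)\<bar> /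
    (2 ^ k * sqrt (mod_const \<eta>) * (1 - log 2 t) powr (- \<eta>)))) \<partial>lborel) \<le> 4"
proof (rule nn_integral_exp_limit)
  show "AE x in lborel. x \<in> {0..<1} \<longrightarrow>
    (\<lambda>i. (fdiff h ^^ k) (lacunary_sum (lac_coeff \<eta>) (\<lambda>_. 0) (2 ^ i - 1)) (2 * pi * x))
      \<longlonglongrightarrow> (fdiff h ^^ k) (lac_series \<eta>) (2 * pi * x)"
    using AE_tendsto_funpow_fdiff[OF AE_tendsto_lac_series[OF assms(2)], of k h 0] by simp
  have "log 2 t \<le> 0"
    using assms by simp
  then have "0 < 2 ^ k * sqrt (mod_const \<eta>) * (1 - log 2 t) powr (- \<eta>)"
    using mod_const_pos[of \<eta>] by (intro mult_pos_pos) auto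
  from nn_integral_exp_lacunary_sum[OF sum_lac_coeff_diff_le[OF assms] this]
  show "(\<integral>\<^sup>+ x \<in> {0..<1}. ennreal (exp (\<bar>(fdiff h ^^ k) (lacunary_sum (lac_coeff \<eta>) (\<lambda>_. 0) (2 ^ i - 1)) (2 * pi * x)\<bar> /
    (2 ^ k * sqrt (mod_const \<eta>) * (1 - log 2 t) powr (- \<eta>)))) \<partial>lborel) \<le> 4" for i
    unfolding funpow_fdiff_lacunary_sum .
qed measurable

text \<open>The scale is 1 because all square sums are at most 1. The division by 1 keeps the shape
  required by \<open>nn_integral_exp_limit\<close>.\<close>

lemma nn_integral_exp_lac_series:
  assumes "\<eta> > 0"
  shows "(\<integral>\<^sup>+ x \<in> {0..<1}. ennreal (exp (\<bar>lac_series \<eta> (2 * pi * x)\<bar> / 1)) \<partial>lborel) \<le> 4"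
proof (rule nn_integral_exp_limit)
  show "AE x in lborel. x \<in> {0..<1} \<longrightarrow>
    (\<lambda>i. lacunary_sum (lac_coeff \<eta>) (\<lambda>_. 0) (2 ^ i - 1) (2 * pi * x)) \<longlonglongrightarrow> lac_series \<eta> (2 * pi * x)"
    using AE_tendsto_lac_series[OF assms, of 0] by simp
  show "(\<integral>\<^sup>+ x \<in> {0..<1}. ennreal (exp (\<bar>lacunary_sum (lac_coeff \<eta>) (\<lambda>_. 0) (2 ^ i - 1) (2 * pi * x)\<bar> / 1)) \<partial>lborel) \<le> 4" for i
    using sum_lac_coeff_square_le[OF assms, of 0 "2 ^ i - 1"]
    by (intro nn_integral_exp_lacunary_sum) (auto simp: lessThan_atLeast0)
qed measurable

section \<open>Fourier coefficients\<close>

text \<open>Left unnormalised: \<open>fourier_coeff_prod\<close> supplies one factor 1/(2 pi) per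
  coordinate, which together give the normalisation of \<open>fourier_coeff\<close>.\<close>

definition line_coeff :: "(real \<Rightarrow> real) \<Rightarrow> int \<Rightarrow> complex" where
  "line_coeff \<phi> k = (LBINT y:{0..<2 * pi}. of_real (\<phi> y) * exp (- (\<i> * of_real (of_int k * y))))"

lemma integral_exp_int:
  "(LBINT y:{0..<2 * pi}. exp (\<i> * of_real (of_int k * y))) = (if k = 0 then 2 * pi else 0)"
proof -
  have "(LBINT y:{0..<2 * pi}. exp (\<i> * of_real (of_int k * y))) =
      (\<integral>y. indicator {0..2 * pi} y *\<^sub>R exp (\<i> * of_real (of_int k * y)) \<partial>lborel)"
    unfolding set_lebesgue_integral_def
    by (rule integral_cong_AE, simp, simp, use AE_lborel_singleton[of "2 * pi"] in eventually_elim)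
      (auto split: split_indicator)
  also have "\<dots> = (if k = 0 then 2 * pi else 0)"
  proof (cases "k = 0")
    case True
    have "(\<integral>y. indicator {0..2 * pi} y *\<^sub>R (1 :: complex) \<partial>lborel) =
        of_real (2 * pi) - of_real 0"
      by (rule integral_FTC_Icc) (auto intro!: derivative_eq_intros continuous_intros
        simp: has_vector_derivative_def scaleR_conv_of_real fun_eq_iff)
    with True show ?thesis by simp
  next
    case False
    define F where "F y = exp (\<i> * of_real (of_int k * y)) / (\<i> * of_int k)" for y :: real
    have "((\<lambda>z. exp (\<i> * (of_int k * z)) / (\<i> * of_int k)) has_field_derivative
        exp (\<i> * of_real (of_int k * y))) (at (of_real y))" for y :: real
      using False by (auto intro!: derivative_eq_intros simp: mult_ac)
    from has_vector_derivative_real_field[OF this]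
    have "(F has_vector_derivative exp (\<i> * of_real (of_int k * y))) (at y within A)" for y A
      by (simp add: F_def [abs_def])
    then have "(\<integral>y. indicator {0..2 * pi} y *\<^sub>R exp (\<i> * of_real (of_int k * y)) \<partial>lborel) = F (2 * pi) - F 0"
      by (intro integral_FTC_Icc) (auto intro!: continuous_intros)
    also have "exp (\<i> * of_real (of_int k * (2 * pi))) = 1"
      using exp_two_pi_i[THEN arg_cong, of "\<lambda>z. z powi k"] exp_integer_2pi[of "of_int k"]
      by (simp add: mult_ac)
    then have "F (2 * pi) - F 0 = 0"
      by (simp add: F_def)
    finally show ?thesis
      using False by simp
  qed
  finally show ?thesis .
qed

lemma set_integrable_continuous_Ico:
  fixes f :: "real \<Rightarrow> 'b::euclidean_space"
  assumes "continuous_on UNIV f"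
  shows "set_integrable lborel {0..<c} f"
  by (rule set_integrable_subset[OF borel_integrable_atLeastAtMost'[of 0 c f]])
    (auto intro: continuous_on_subset[OF assms])

lemma line_coeff_cos:
  assumes "N > 0"
  shows "line_coeff (\<lambda>y. cos (real N * y)) k = (if \<bar>k\<bar> = int N then pi else 0)"
proof -
  have e: "of_real (cos (real N * y)) * exp (- (\<i> * of_real (of_int k * y))) =
      (exp (\<i> * of_real (of_int (int N - k) * y)) + exp (\<i> * of_real (of_int (- int N - k) * y))) / 2" for y
  proof -
    have "of_real (cos (real N * y)) = (exp (\<i> * of_real (real N * y)) + exp (- (\<i> * of_real (real N * y)))) / 2"
      by (simp add: cos_of_real[symmetric] cos_exp_eq)
    then show ?thesis
      by (simp add: add_divide_distrib exp_add[symmetric] ring_distribs)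
  qed
  have int: "set_integrable lborel {0..<2 * pi} (\<lambda>y. exp (\<i> * of_real (of_int l * y)))" for l
    by (intro set_integrable_continuous_Ico continuous_intros)
  have "line_coeff (\<lambda>y. cos (real N * y)) k =
      ((if int N - k = 0 then 2 * pi else 0) + (if - int N - k = 0 then 2 * pi else 0)) / 2"
    unfolding line_coeff_def e set_integral_divide_zero set_integral_add(2)[OF int int] integral_exp_int by simp
  then show ?thesis
    using assms by (cases "k = int N"; cases "k = - int N"; auto)
qed

lemma set_integral_sum_fun:
  fixes f :: "'i \<Rightarrow> 'a \<Rightarrow> 'b::{banach, second_countable_topology}"
  assumes "\<And>i. i \<in> I \<Longrightarrow> set_integrable M A (f i)"
  shows "(LINT x:A|M. (\<Sum>i\<in>I. f i x)) = (\<Sum>i\<in>I. LINT x:A|M. f i x)"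
  using assms by (simp add: set_lebesgue_integral_def set_integrable_def scaleR_sum_right)

lemma line_coeff_lacunary_sum:
  "line_coeff (lacunary_sum c (\<lambda>_. 0) M) k = (\<Sum>n<M. of_real (c n) * (if \<bar>k\<bar> = 2 ^ n then pi else 0))"
proof -
  have "line_coeff (lacunary_sum c (\<lambda>_. 0) M) k =
      (LBINT y:{0..<2 * pi}. (\<Sum>n<M. of_real (c n) * (of_real (cos (2 ^ n * y)) * exp (- (\<i> * of_real (of_int k * y))))))"
    by (simp add: line_coeff_def lacunary_sum_def sum_distrib_right mult.assoc)
  also have "\<dots> = (\<Sum>n<M. of_real (c n) * line_coeff (\<lambda>y. cos (2 ^ n * y)) k)"
    unfolding line_coeff_def
    by (subst set_integral_sum_fun) (auto intro!: set_integrable_continuous_Ico continuous_intros)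
  also have "\<dots> = (\<Sum>n<M. of_real (c n) * (if \<bar>k\<bar> = 2 ^ n then pi else 0))"
    using line_coeff_cos[of "2 ^ n" k for n] by simp
  finally show ?thesis .
qed

lemma nn_integral_lac_block_Ico:
  assumes "\<eta> > 0"
  shows "(\<integral>\<^sup>+ y \<in> {0..<2 * pi}. ennreal \<bar>lac_block \<eta> i y\<bar> \<partial>lborel) \<le> ennreal (8 * pi * (2 powr (- \<eta>)) ^ i)"
proof -
  have "(\<integral>\<^sup>+ y \<in> {0..<2 * pi}. ennreal \<bar>lac_block \<eta> i y\<bar> \<partial>lborel) =
      ennreal (2 * pi) * (\<integral>\<^sup>+ x \<in> {0..<1}. ennreal \<bar>lac_block \<eta> i (2 * pi * x + 0)\<bar> \<partial>lborel)"
    by (subst nn_integral_real_affine[of _ "2 * pi" 0])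
      (auto intro!: arg_cong2[of _ _ _ _ "(*)"] nn_integral_cong split: split_indicator
        simp: zero_le_mult_iff pi_gt_zero[unfolded not_le[symmetric]])
  also have "\<dots> \<le> ennreal (2 * pi) * ennreal (4 * (2 powr (- \<eta>)) ^ i)"
    by (intro mult_left_mono nn_integral_lac_block assms) simp
  also have "\<dots> = ennreal (8 * pi * (2 powr (- \<eta>)) ^ i)"
    by (simp flip: ennreal_mult)
  finally show ?thesis .
qed

text \<open>The L1 norms of the blocks are summable and the exponential is unimodular, so the series
  can be integrated term by term. Grouping into blocks is essential here, since single terms need
  not be absolutely summable.\<close>

lemma lac_series_line_coeff:
  assumes "\<eta> > 0"
  shows set_integrable_lac_series: "set_integrable lborel {0..<2 * pi} (\<lambda>y. complex_of_real (lac_series \<eta> y) * exp (- (\<i> * of_real (of_int k * y))))"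
    and sums_line_coeff_lac_series: "(\<lambda>i. line_coeff (lac_block \<eta> i) k) sums line_coeff (lac_series \<eta>) k"
proof -
  define E where "E y = exp (- (\<i> * of_real (of_int k * y)))" for y :: real
  have normE: "norm (E y) = 1" for y
    by (simp add: E_def)
  have [measurable]: "E \<in> borel_measurable borel"
    unfolding E_def [abs_def] by measurable
  define f where "f i y = indicator {0..<2 * pi} y *\<^sub>R (complex_of_real (lac_block \<eta> i y) * E y)" for i y
  have [measurable]: "f i \<in> borel_measurable borel" for i
    unfolding f_def [abs_def] by measurable
  have norm_f: "norm (f i y) = indicator {0..<2 * pi} y * \<bar>lac_block \<eta> i y\<bar>" for i y
    by (simp add: f_def norm_mult normE)
  have nn: "(\<integral>\<^sup>+ y. ennreal (norm (f i y)) \<partial>lborel) \<le> ennreal (8 * pi * (2 powr (- \<eta>)) ^ i)" for i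
    using nn_integral_lac_block_Ico[OF assms, of i]
    by (simp add: norm_f ennreal_mult' ennreal_indicator mult.commute)
  have int: "integrable lborel (f i)" for i
    using nn[of i] by (intro integrableI_bounded) (auto intro: le_less_trans)
  have "AE y in lborel. y \<in> {0..<2 * pi} \<longrightarrow> summable (\<lambda>i. \<bar>lac_block \<eta> i y\<bar>)"
    by (rule AE_summable_geometric[of _ _ "2 powr (- \<eta>)" "8 * pi"])
      (use assms nn_integral_lac_block_Ico in \<open>auto simp: powr_less_one\<close>)
  then have ae: "AE y in lborel. summable (\<lambda>i. norm (f i y))"
    by eventually_elim (auto simp: norm_f split: split_indicator)
  have norm_le: "norm (\<integral> y. norm (f i y) \<partial>lborel) \<le> 8 * pi * (2 powr (- \<eta>)) ^ i" for i
  proof -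
    have "ennreal (\<integral> y. norm (f i y) \<partial>lborel) = (\<integral>\<^sup>+ y. ennreal (norm (f i y)) \<partial>lborel)"
      using int[of i] by (intro nn_integral_eq_integral[symmetric]) auto
    with nn[of i] have "ennreal (\<integral> y. norm (f i y) \<partial>lborel) \<le> ennreal (8 * pi * (2 powr (- \<eta>)) ^ i)"
      by simp
    then have "(\<integral> y. norm (f i y) \<partial>lborel) \<le> 8 * pi * (2 powr (- \<eta>)) ^ i"
      by (subst (asm) ennreal_le_iff) auto
    then show ?thesis
      by simp
  qed
  have "summable (\<lambda>i. 8 * pi * (2 powr (- \<eta>)) ^ i)"
    using assms by (intro summable_mult summable_geometric) (simp add: powr_less_one)
  then have sm: "summable (\<lambda>i. \<integral> y. norm (f i y) \<partial>lborel)"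
    by (rule summable_comparison_test') (rule norm_le)
  \<comment> \<open>Only almost everywhere: off the convergence set \<open>suminf\<close> carries no
    information.\<close>
  have eq: "AE y in lborel. (\<Sum>i. f i y) = indicator {0..<2 * pi} y *\<^sub>R (complex_of_real (lac_series \<eta> y) * E y)"
    using ae
  proof eventually_elim
    case (elim y)
    show ?case
    proof (cases "y \<in> {0..<2 * pi}")
      case True
      with elim have "summable (\<lambda>i. \<bar>lac_block \<eta> i y\<bar>)"
        by (simp add: norm_f)
      then have "summable (\<lambda>i. lac_block \<eta> i y)"
        by (rule summable_rabs_cancel)
      then have "(\<lambda>i. complex_of_real (lac_block \<eta> i y) * E y) sums (complex_of_real (lac_series \<eta> y) * E y)"
        unfolding lac_series_def by (intro sums_mult2 sums_of_real summable_sums)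
      with True show ?thesis
        by (simp add: f_def sums_iff)
    qed (simp add: f_def)
  qed
  have [measurable]: "(\<lambda>y. indicator {0..<2 * pi} y *\<^sub>R (complex_of_real (lac_series \<eta> y) * E y)) \<in> borel_measurable lborel"
    "(\<lambda>y. \<Sum>i. f i y) \<in> borel_measurable lborel"
    by measurable
  have "integrable lborel (\<lambda>y. indicator {0..<2 * pi} y *\<^sub>R (complex_of_real (lac_series \<eta> y) * E y))"
    using integrable_suminf[OF int ae sm] integrable_cong_AE[OF _ _ eq] by simp
  moreover have "(\<lambda>i. integral\<^sup>L lborel (f i)) sums (\<integral> y. indicator {0..<2 * pi} y *\<^sub>R (complex_of_real (lac_series \<eta> y) * E y) \<partial>lborel)"
    using sums_integral[OF int ae sm] integral_cong_AE[OF _ _ eq] by simp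
  ultimately show "set_integrable lborel {0..<2 * pi} (\<lambda>y. complex_of_real (lac_series \<eta> y) * exp (- (\<i> * of_real (of_int k * y))))"
    "(\<lambda>i. line_coeff (lac_block \<eta> i) k) sums line_coeff (lac_series \<eta>) k"
    unfolding set_integrable_def line_coeff_def set_lebesgue_integral_def f_def E_def by auto
qed

lemma line_coeff_lac_series_limit:
  assumes "\<eta> > 0"
  shows "(\<lambda>I. \<Sum>n<2 ^ I - 1. complex_of_real (lac_coeff \<eta> n) * (if \<bar>k\<bar> = 2 ^ n then pi else 0))
    \<longlonglongrightarrow> line_coeff (lac_series \<eta>) k"
proof -
  have "(\<Sum>i<I. line_coeff (lac_block \<eta> i) k) = line_coeff (lacunary_sum (lac_coeff \<eta>) (\<lambda>_. 0) (2 ^ I - 1)) k" for I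
  proof -
    have "(\<Sum>i<I. line_coeff (lac_block \<eta> i) k) =
        (LBINT y:{0..<2 * pi}. (\<Sum>i<I. of_real (lac_block \<eta> i y) * exp (- (\<i> * of_real (of_int k * y)))))"
      unfolding line_coeff_def lac_block_def
      by (subst set_integral_sum_fun) (auto intro!: set_integrable_continuous_Ico continuous_intros)
    also have "\<dots> = line_coeff (lacunary_sum (lac_coeff \<eta>) (\<lambda>_. 0) (2 ^ I - 1)) k"
      unfolding line_coeff_def by (simp flip: sum_distrib_right of_real_sum add: sum_lac_block)
    finally show ?thesis .
  qed
  with sums_line_coeff_lac_series[OF assms, of k] show ?thesis
    by (simp add: sums_def line_coeff_lacunary_sum)
qed

lemma line_coeff_lac_series:
  assumes "\<eta> > 0" "\<bar>k\<bar> = 2 ^ N"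
  shows "line_coeff (lac_series \<eta>) k = of_real (pi * lac_coeff \<eta> N)"
proof (rule LIMSEQ_unique[OF line_coeff_lac_series_limit[OF assms(1)]])
  show "(\<lambda>I. \<Sum>n<2 ^ I - 1. complex_of_real (lac_coeff \<eta> n) * (if \<bar>k\<bar> = 2 ^ n then pi else 0))
    \<longlonglongrightarrow> of_real (pi * lac_coeff \<eta> N)"
  \<comment> \<open>The sequence is constant from I = N + 1 on, because the sum then contains the
    index \<open>N\<close>.\<close>
  proof (rule tendsto_eventually, rule eventually_sequentiallyI[of "Suc N"])
    fix I assume "Suc N \<le> I"
    then have "N < 2 ^ I - 1"
      using less_exp[of I] by linarith
    have "(\<Sum>n<2 ^ I - 1. complex_of_real (lac_coeff \<eta> n) * complex_of_real (if \<bar>k\<bar> = 2 ^ n then pi else 0))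
      = (\<Sum>n<2 ^ I - 1. if n = N then of_real (pi * lac_coeff \<eta> N) else 0)"
      using assms(2) by (intro sum.cong) auto
    also have "\<dots> = of_real (pi * lac_coeff \<eta> N)"
      using \<open>N < 2 ^ I - 1\<close> by (subst sum.delta) auto
    finally show "(\<Sum>n<2 ^ I - 1. complex_of_real (lac_coeff \<eta> n) * complex_of_real (if \<bar>k\<bar> = 2 ^ n then pi else 0))
        = of_real (pi * lac_coeff \<eta> N)" .
  qed
qed

lemma line_coeff_lac_series_0:
  assumes "\<eta> > 0" "\<And>n. \<bar>k\<bar> \<noteq> 2 ^ n"
  shows "line_coeff (lac_series \<eta>) k = 0"
  using line_coeff_lac_series_limit[OF assms(1), of k] assms(2) by (simp add: LIMSEQ_const_iff)

section \<open>Products of functions of one variable\<close>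

abbreviation unit_cube :: "(real ^ 'm) set" where
  "unit_cube \<equiv> {x. \<forall>j. 0 \<le> x $ j \<and> x $ j < 1}"

lemma indicator_unit_cube:
  "(indicator unit_cube x :: ennreal) = (\<Prod>j\<in>UNIV. indicator {0..<1} (x $ j))"
proof (cases "x \<in> unit_cube")
  case False
  then obtain j where "x $ j \<notin> {0..<1}"
    by auto
  then have "(\<Prod>j\<in>UNIV. indicator {0..<1} (x $ j) :: ennreal) = 0"
    by (intro prod_zero) (auto intro!: exI[of _ j])
  with False show ?thesis
    by simp
qed simp

lemma sets_unit_cube [measurable]: "unit_cube \<in> sets borel"
proof -
  have "{x :: real ^ 'm. 0 \<le> x $ j \<and> x $ j < 1} \<in> sets borel" for j
    by measurable
  then have "(\<Inter>j. {x :: real ^ 'm. 0 \<le> x $ j \<and> x $ j < 1}) \<in> sets borel"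
    by (intro sets.finite_INT) auto
  also have "(\<Inter>j. {x :: real ^ 'm. 0 \<le> x $ j \<and> x $ j < 1}) = unit_cube"
    by auto
  finally show ?thesis .
qed

lemma nn_integral_unit_cube_coord:
  assumes [measurable]: "g \<in> borel_measurable borel"
  shows "(\<integral>\<^sup>+ x \<in> unit_cube. g (x $ i) \<partial>lborel) = (\<integral>\<^sup>+ y \<in> {0..<1}. g y \<partial>lborel)"
proof -
  define f where "f j y = (if j = i then g y else 1) * indicator {0..<1::real} y" for j y
  have "(\<integral>\<^sup>+ x \<in> unit_cube. g (x $ i) \<partial>lborel) = (\<integral>\<^sup>+ x. (\<Prod>j\<in>UNIV. f j (x $ j)) \<partial>lborel)"
    by (simp add: indicator_unit_cube f_def prod.distrib)
  also have "\<dots> = (\<Prod>j\<in>UNIV. \<integral>\<^sup>+ y. f j y \<partial>lborel)"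
    by (rule nn_integral_lborel_vec_prod) (simp add: f_def)
  also have "\<dots> = (\<Prod>j\<in>UNIV. if j = i then \<integral>\<^sup>+ y \<in> {0..<1}. g y \<partial>lborel else 1)"
    by (intro prod.cong) (auto simp: f_def)
  also have "\<dots> = (\<integral>\<^sup>+ y \<in> {0..<1}. g y \<partial>lborel)"
    by simp
  finally show ?thesis .
qed

text \<open>Markov's inequality for the exponential. The remaining coordinates integrate to 1 over
  the unit interval.\<close>

lemma emeasure_unit_cube_tail:
  fixes i :: "'m::finite"
  assumes [measurable]: "\<psi> \<in> borel_measurable borel"
    and bound: "(\<integral>\<^sup>+ y \<in> {0..<1}. ennreal (exp (\<bar>\<psi> (2 * pi * y)\<bar> / \<sigma>)) \<partial>lborel) \<le> 4" and s: "\<sigma> > 0"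
  shows "emeasure lborel (unit_cube \<inter> {x. y < \<bar>\<psi> (2 * pi * (x $ i))\<bar>}) \<le> ennreal (4 * exp (- (y / \<sigma>)))"
proof -
  let ?A = "unit_cube \<inter> {x. y < \<bar>\<psi> (2 * pi * (x $ i))\<bar>}"
  have [measurable]: "{x :: real ^ 'm. y < \<bar>\<psi> (2 * pi * (x $ i))\<bar>} \<in> sets borel"
    by measurable
  have "ennreal (exp (y / \<sigma>)) * emeasure lborel ?A = (\<integral>\<^sup>+ x. ennreal (exp (y / \<sigma>)) * indicator ?A x \<partial>lborel)"
    by (rule nn_integral_cmult_indicator[symmetric]) simp
  also have "\<dots> \<le> (\<integral>\<^sup>+ x \<in> unit_cube. ennreal (exp (\<bar>\<psi> (2 * pi * (x $ i))\<bar> / \<sigma>)) \<partial>lborel)"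
    using s by (intro nn_integral_mono) (auto split: split_indicator intro!: ennreal_leI divide_right_mono)
  also have "\<dots> \<le> 4"
    using bound by (subst nn_integral_unit_cube_coord[of "\<lambda>y. ennreal (exp (\<bar>\<psi> (2 * pi * y)\<bar> / \<sigma>))"]) auto
  finally have "ennreal (exp (- (y / \<sigma>))) * (ennreal (exp (y / \<sigma>)) * emeasure lborel ?A) \<le> ennreal (exp (- (y / \<sigma>))) * 4"
    by (rule mult_left_mono) simp
  moreover have "ennreal (exp (- (y / \<sigma>))) * ennreal (exp (y / \<sigma>)) = 1"
    by (simp flip: ennreal_mult exp_add)
  ultimately have "emeasure lborel ?A \<le> ennreal (exp (- (y / \<sigma>))) * 4"
    by (simp only: mult.assoc[symmetric] mult_1_left)
  also have "\<dots> = ennreal (exp (- (y / \<sigma>)) * 4)"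
    by (simp add: ennreal_mult)
  finally show ?thesis
    by (simp only: mult.commute[of 4])
qed

text \<open>The constant produced by \<open>lorentz_norm_le_of_exp_tail\<close>.\<close>

definition lorentz_const :: "real \<Rightarrow> real \<Rightarrow> real" where
  "lorentz_const p \<tau> = 2 powr (1 / \<tau>) * (2 * p * 4 powr (1 / (2 * p)))"

text \<open>All factors except the one at \<open>i\<close> are bounded, so the tail of the product
  at level y is controlled by the tail of that factor at level y/C.\<close>

lemma lorentz_norm_prod_le:
  fixes \<psi> :: "'m::finite \<Rightarrow> real \<Rightarrow> real"
  assumes p: "p > 0" and tau: "\<tau> > 0"
    and [measurable]: "\<psi> i \<in> borel_measurable borel"
    and bound: "(\<integral>\<^sup>+ y \<in> {0..<1}. ennreal (exp (\<bar>\<psi> i (2 * pi * y)\<bar> / B i)) \<partial>lborel) \<le> 4"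
    and B: "\<And>j. B j > 0" and le: "\<And>j y. j \<noteq> i \<Longrightarrow> \<bar>\<psi> j y\<bar> \<le> B j"
  shows "lorentz_norm p \<tau> (\<lambda>x. \<Prod>j\<in>UNIV. \<psi> j (x $ j)) \<le> ennreal (lorentz_const p \<tau> * (\<Prod>j\<in>UNIV. B j))"
proof -
  define C where "C = (\<Prod>j\<in>UNIV - {i}. B j)"
  have C: "C > 0"
    unfolding C_def by (intro prod_pos ballI B)
  have prod: "(\<Prod>j\<in>UNIV. B j) = B i * C"
    unfolding C_def by (rule prod.remove) auto
  have abs_le: "\<bar>\<Prod>j\<in>UNIV. \<psi> j (x $ j)\<bar> \<le> \<bar>\<psi> i (x $ i)\<bar> * C" for x
  proof -
    have "\<bar>\<Prod>j\<in>UNIV. \<psi> j (x $ j)\<bar> = \<bar>\<psi> i (x $ i)\<bar> * (\<Prod>j\<in>UNIV - {i}. \<bar>\<psi> j (x $ j)\<bar>)"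
      by (subst abs_prod, rule prod.remove) auto
    also have "\<dots> \<le> \<bar>\<psi> i (x $ i)\<bar> * C"
      unfolding C_def by (intro mult_left_mono prod_mono) (auto intro: le)
    finally show ?thesis .
  qed
  show ?thesis
    unfolding prod lorentz_const_def
  proof (rule lorentz_norm_le_of_exp_tail[OF p tau])
    show "0 < B i * C" using B[of i] C by simp
    fix y :: real assume "0 \<le> y"
    \<comment> \<open>Only the factor at \<open>i\<close> is known to be measurable, so the level
      set of the product is enclosed in a measurable set.\<close>
    let ?A = "unit_cube \<inter> {x :: real ^ 'm. y / C < \<bar>\<psi> i (2 * pi * (x $ i))\<bar>}"
    have [measurable]: "{x :: real ^ 'm. y / C < \<bar>\<psi> i (2 * pi * (x $ i))\<bar>} \<in> sets borel"
      by measurable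
    have "{x. (\<forall>j. 0 \<le> x $ j \<and> x $ j < 1) \<and> norm (\<Prod>j\<in>UNIV. \<psi> j (((2 * pi) *\<^sub>R x) $ j)) > y} \<subseteq> ?A"
    proof safe
      fix x :: "real ^ 'm"
      assume "y < norm (\<Prod>j\<in>UNIV. \<psi> j (((2 * pi) *\<^sub>R x) $ j))"
      also have "\<dots> \<le> \<bar>\<psi> i (2 * pi * (x $ i))\<bar> * C"
        using abs_le[of "(2 * pi) *\<^sub>R x"] by simp
      finally show "y / C < \<bar>\<psi> i (2 * pi * (x $ i))\<bar>"
        using C by (simp add: divide_less_eq)
    qed
    then have "emeasure lebesgue {x. (\<forall>j. 0 \<le> x $ j \<and> x $ j < 1) \<and>
        norm (\<Prod>j\<in>UNIV. \<psi> j (((2 * pi) *\<^sub>R x) $ j)) > y} \<le> emeasure lebesgue ?A"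
      by (rule emeasure_mono) simp
    also have "\<dots> = emeasure lborel ?A"
      by simp
    also have "\<dots> \<le> ennreal (4 * exp (- (y / C / B i)))"
      by (rule emeasure_unit_cube_tail) (use bound B in auto)
    also have "y / C / B i = y / (B i * C)"
      by simp
    finally show "emeasure lebesgue {x. (\<forall>j. 0 \<le> x $ j \<and> x $ j < 1) \<and>
        norm (\<Prod>j\<in>UNIV. \<psi> j (((2 * pi) *\<^sub>R x) $ j)) > y} \<le> ennreal (4 * exp (- (y / (B i * C))))" .
  qed
qed

section \<open>Lower bound for products of cosines\<close>

lemma nn_integral_cos_square:
  "(\<integral>\<^sup>+ x \<in> {0..<1}. ennreal ((cos (2 ^ e * (2 * pi * x)))\<^sup>2) \<partial>lborel) = ennreal (1 / 2)"
proof -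
  define c where "c = (2::real) ^ e * (2 * pi)"
  have c: "c > 0" by (simp add: c_def)
  define F where "F x = x / 2 + sin (2 * (c * x)) / (4 * c)" for x
  have "(\<integral>\<^sup>+ x \<in> {0..<1}. ennreal ((cos (c * x))\<^sup>2) \<partial>lborel) = (\<integral>\<^sup>+ x \<in> {0..1}. ennreal ((cos (c * x))\<^sup>2) \<partial>lborel)"
    by (rule nn_integral_cong_AE, use AE_lborel_singleton[of 1] in eventually_elim) (auto split: split_indicator)
  also have "\<dots> = F 1 - F 0"
  proof (rule nn_integral_FTC_Icc)
    fix x :: real
    have "(F has_real_derivative (1 / 2 + cos (2 * (c * x)) * (2 * c) / (4 * c))) (at x)"
      unfolding F_def by (auto intro!: derivative_eq_intros)
    also have "1 / 2 + cos (2 * (c * x)) * (2 * c) / (4 * c) = (cos (c * x))\<^sup>2"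
      using c cos_double_cos[of "c * x"] by (simp add: field_simps)
    finally show "DERIV F x :> (cos (c * x))\<^sup>2" .
  qed auto
  also have "F 1 - F 0 = 1 / 2"
  proof -
    have "2 * c = 2 * pi * of_int (2 * 2 ^ e)"
      by (simp add: c_def)
    then have "sin (2 * c) = 0"
      using sin_integer_2pi[of "of_int (2 * 2 ^ e)"] by (metis Ints_of_int)
    then show ?thesis
      by (simp add: F_def)
  qed
  finally show ?thesis
    by (simp add: c_def mult.assoc)
qed

text \<open>A Paley-Zygmund argument: the square of the cosine product is at most 1 and has mean
  2\<kappa> over the cube, whatever the frequencies. Values with square at most \<kappa> account for
  at most half of this mean, so the set where the square exceeds \<kappa> has measure at least
  \<kappa>.\<close>

lemma lorentz_norm_prod_cos_ge:
  fixes f :: "real ^ 'm \<Rightarrow> 'a::real_normed_vector"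
  assumes p: "p > 0" and tau: "\<tau> > 0" and a: "a \<ge> 0"
    and f: "\<And>x. norm (f x) = a * (\<Prod>j\<in>UNIV. \<bar>cos (2 ^ e j * (x $ j))\<bar>)"
  defines "\<kappa> \<equiv> (1 / 2) ^ Suc CARD('m)"
  shows "ennreal (a * sqrt \<kappa> * \<kappa> powr (1 / p)) \<le> lorentz_norm p \<tau> f"
proof (rule lorentz_norm_ge[OF p tau])
  have k: "0 < \<kappa>" "\<kappa> \<le> 1"
    unfolding \<kappa>_def by (simp, intro power_le_one) simp_all
  show "0 \<le> a * sqrt \<kappa>" "0 < \<kappa>" "\<kappa> \<le> 1"
    using k a by auto
  define P where "P x = (\<Prod>j\<in>UNIV. \<bar>cos (2 ^ e j * (2 * pi * (x $ j)))\<bar>)" for x :: "real ^ 'm"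
  have P: "0 \<le> P x" "P x \<le> 1" for x
    by (auto simp: P_def intro!: prod_nonneg prod_le_1)
  have P2: "(P x)\<^sup>2 = (\<Prod>j\<in>UNIV. (cos (2 ^ e j * (2 * pi * (x $ j))))\<^sup>2)" for x
    by (simp add: P_def prod_power_distrib)
  have [measurable]: "P \<in> borel_measurable borel"
    unfolding P_def [abs_def] by measurable
  let ?E = "unit_cube \<inter> {x. sqrt \<kappa> < P x}"
  have [measurable]: "{x. sqrt \<kappa> < P x} \<in> sets borel"
    by measurable
  have "ennreal ((1 / 2) ^ CARD('m)) = (\<Prod>j\<in>(UNIV :: 'm set). ennreal (1 / 2))"
    by (simp only: prod_constant ennreal_power[symmetric])
  also have "\<dots> = (\<Prod>j\<in>UNIV. \<integral>\<^sup>+ y \<in> {0..<1}. ennreal ((cos (2 ^ e j * (2 * pi * y)))\<^sup>2) \<partial>lborel)"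
    by (simp only: nn_integral_cos_square)
  also have "\<dots> = (\<integral>\<^sup>+ x. (\<Prod>j\<in>UNIV. ennreal ((cos (2 ^ e j * (2 * pi * (x $ j))))\<^sup>2) * indicator {0..<1} (x $ j)) \<partial>lborel)"
    by (rule nn_integral_lborel_vec_prod[symmetric]) simp
  also have "\<dots> = (\<integral>\<^sup>+ x \<in> unit_cube. ennreal ((P x)\<^sup>2) \<partial>lborel)"
    by (simp add: indicator_unit_cube prod.distrib P2 prod_ennreal)
  also have "\<dots> \<le> (\<integral>\<^sup>+ x. ennreal \<kappa> * indicator unit_cube x + indicator ?E x \<partial>lborel)"
  proof (intro nn_integral_mono)
    fix x :: "real ^ 'm"
    show "ennreal ((P x)\<^sup>2) * indicator unit_cube x \<le> ennreal \<kappa> * indicator unit_cube x + indicator ?E x"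
    proof (cases "sqrt \<kappa> < P x")
      case True
      have "ennreal ((P x)\<^sup>2) \<le> 1"
        using P[of x] by (auto simp: power_le_one)
      with True show ?thesis
        by (auto split: split_indicator intro: add_increasing)
    next
      case False
      then have "(P x)\<^sup>2 \<le> (sqrt \<kappa>)\<^sup>2"
        using P[of x] by (intro power_mono) auto
      then have "ennreal ((P x)\<^sup>2) \<le> ennreal \<kappa>"
        using k by (auto intro: ennreal_leI)
      then show ?thesis
        by (auto split: split_indicator intro: add_increasing2)
    qed
  qed
  also have "\<dots> = ennreal \<kappa> * emeasure lborel (unit_cube :: (real ^ 'm) set) + emeasure lborel ?E"
    by (subst nn_integral_add) (simp_all add: nn_integral_cmult_indicator)
  also have "emeasure lborel (unit_cube :: (real ^ 'm) set) = 1"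
    using nn_integral_unit_cube_coord[of "\<lambda>_. 1" undefined] by (simp add: nn_integral_indicator)
  also have "(1 / 2) ^ CARD('m) = \<kappa> + \<kappa>"
    by (simp add: \<kappa>_def)
  also have "ennreal (\<kappa> + \<kappa>) = ennreal \<kappa> + ennreal \<kappa>"
    using k by (intro ennreal_plus) auto
  finally have "ennreal \<kappa> + ennreal \<kappa> \<le> ennreal \<kappa> + emeasure lborel ?E"
    by (simp only: mult_1_right)
  then have "ennreal \<kappa> = \<infinity> \<or> ennreal \<kappa> \<le> emeasure lborel ?E"
    by (simp only: ennreal_add_left_cancel_le)
  then have E: "ennreal \<kappa> \<le> emeasure lborel ?E"
    by simp
  fix y :: real assume y: "0 \<le> y" "y < a * sqrt \<kappa>"
  let ?B = "unit_cube \<inter> {x. y < a * P x}"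
  have [measurable]: "{x. y < a * P x} \<in> sets borel"
    by measurable
  have "y < a * P x" if "sqrt \<kappa> < P x" for x
  proof -
    have "a * sqrt \<kappa> \<le> a * P x"
      using a that by (intro mult_left_mono) auto
    with y show ?thesis
      by linarith
  qed
  then have "?E \<subseteq> ?B"
    by blast
  then have "emeasure lborel ?E \<le> emeasure lborel ?B"
    by (rule emeasure_mono) simp
  moreover have "{x. (\<forall>j. 0 \<le> x $ j \<and> x $ j < 1) \<and> norm (f ((2 * pi) *\<^sub>R x)) > y} = ?B"
    by (auto simp: f P_def)
  ultimately show "ennreal \<kappa> \<le> emeasure lebesgue {x. (\<forall>j. 0 \<le> x $ j \<and> x $ j < 1) \<and> norm (f ((2 * pi) *\<^sub>R x)) > y}"
    using E by simp
qed

section \<open>Fourier coefficients and dyadic blocks of products\<close>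

lemma fourier_coeff_prod:
  fixes \<psi> :: "'m::finite \<Rightarrow> real \<Rightarrow> real"
  assumes [measurable]: "\<And>j. \<psi> j \<in> borel_measurable borel"
    and int: "\<And>j k. set_integrable lborel {0..<2 * pi} (\<lambda>y. complex_of_real (\<psi> j y) * exp (- (\<i> * of_real (of_int k * y))))"
  shows "fourier_coeff (\<lambda>x. \<Prod>j\<in>UNIV. \<psi> j (x $ j)) n = (\<Prod>j\<in>UNIV. line_coeff (\<psi> j) (n $ j) / (2 * pi))"
proof -
  let ?C = "{x :: real ^ 'm. \<forall>j. 0 \<le> x $ j \<and> x $ j < 2 * pi}"
  define g where "g j y = indicator {0..<2 * pi} y *\<^sub>R (complex_of_real (\<psi> j y) * exp (- (\<i> * of_real (of_int (n $ j) * y))))" for j y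
  have eq: "indicator ?C x *\<^sub>R (complex_of_real (\<Prod>j\<in>UNIV. \<psi> j (x $ j)) * cnj (trig n x)) = (\<Prod>j\<in>UNIV. g j (x $ j))" for x
  proof (cases "x \<in> ?C")
    case True
    have "cnj (trig n x) = exp (\<Sum>j\<in>UNIV. - (\<i> * of_real (of_int (n $ j) * (x $ j))))"
      by (simp add: trig_def exp_cnj sum_distrib_left sum_negf)
    also have "\<dots> = (\<Prod>j\<in>UNIV. exp (- (\<i> * of_real (of_int (n $ j) * (x $ j)))))"
      by (rule exp_sum) simp
    finally show ?thesis
      using True by (simp add: g_def prod.distrib of_real_prod)
  next
    case False
    then obtain j where "x $ j \<notin> {0..<2 * pi}"
      by auto
    then have "(\<Prod>j\<in>UNIV. g j (x $ j)) = 0"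
      by (intro prod_zero) (auto intro!: exI[of _ j] simp: g_def)
    with False show ?thesis
      by simp
  qed
  have [measurable]: "g j \<in> borel_measurable borel" for j
    unfolding g_def [abs_def] by measurable
  have "(LINT x:?C|lebesgue. complex_of_real (\<Prod>j\<in>UNIV. \<psi> j (x $ j)) * cnj (trig n x))
      = (\<integral>x. (\<Prod>j\<in>UNIV. g j (x $ j)) \<partial>lebesgue)"
    unfolding set_lebesgue_integral_def eq ..
  also have "\<dots> = (\<integral>x. (\<Prod>j\<in>UNIV. g j (x $ j)) \<partial>lborel)"
    by (rule integral_completion) measurable
  also have "\<dots> = (\<Prod>j\<in>UNIV. \<integral>y. g j y \<partial>lborel)"
    by (rule integral_lborel_vec_prod) (use int in \<open>simp add: g_def set_integrable_def\<close>)
  also have "\<dots> = (\<Prod>j\<in>UNIV. line_coeff (\<psi> j) (n $ j))"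
    by (simp add: g_def line_coeff_def set_lebesgue_integral_def)
  finally show ?thesis
    unfolding fourier_coeff_def prod_dividef prod_constant by simp
qed

lemma Collect_vec_eq_image_PiE: "{k. \<forall>j. k $ j \<in> D j} = vec_lambda ` PiE UNIV D"
proof (intro equalityI subsetI)
  fix k assume "k \<in> {k. \<forall>j. k $ j \<in> D j}"
  then show "k \<in> vec_lambda ` PiE UNIV D"
    by (intro image_eqI[of _ _ "vec_nth k"]) (auto simp: PiE_def)
qed (auto simp: PiE_def Pi_def)

text \<open>A dyadic block is a Cartesian product of bands, so the sum of products factors. Writing
  each index as a successor makes the integer part equal to 2^e and avoids the degenerate index
  0.\<close>

lemma delta_block_prod:
  fixes \<psi> :: "'m::finite \<Rightarrow> real \<Rightarrow> real"
  assumes "\<And>j. \<psi> j \<in> borel_measurable borel"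
    and "\<And>j k. set_integrable lborel {0..<2 * pi} (\<lambda>y. complex_of_real (\<psi> j y) * exp (- (\<i> * of_real (of_int k * y))))"
  shows "delta_block (\<chi> j. Suc (e j)) (\<lambda>x. \<Prod>j\<in>UNIV. \<psi> j (x $ j)) x =
    (\<Prod>j\<in>UNIV. \<Sum>k | 2 ^ e j \<le> \<bar>k\<bar> \<and> \<bar>k\<bar> < 2 ^ Suc (e j).
      line_coeff (\<psi> j) k / (2 * pi) * exp (\<i> * of_real (of_int k * (x $ j))))"
proof -
  let ?D = "\<lambda>j. {k::int. 2 ^ e j \<le> \<bar>k\<bar> \<and> \<bar>k\<bar> < 2 ^ Suc (e j)}"
  let ?F = "\<lambda>j k. line_coeff (\<psi> j) k / (2 * pi) * exp (\<i> * of_real (of_int k * (x $ j)))"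
  have "\<lfloor>(2::real) powr (real (Suc a) - 1)\<rfloor> = 2 ^ a" for a
    by (simp add: powr_realpow floor_eq_iff)
  then have "dyadic_block (\<chi> j. Suc (e j)) = {k. \<forall>j. k $ j \<in> ?D j}"
    by (simp add: dyadic_block_def del: power_Suc)
  then have D: "dyadic_block (\<chi> j. Suc (e j)) = vec_lambda ` PiE UNIV ?D"
    by (simp only: Collect_vec_eq_image_PiE)
  have fin: "finite (?D j)" for j
    by (rule finite_subset[of _ "{- (2 ^ Suc (e j)) .. 2 ^ Suc (e j)}"]) auto
  have "trig n x = (\<Prod>j\<in>UNIV. exp (\<i> * of_real (of_int (n $ j) * (x $ j))))" for n
    by (simp add: trig_def sum_distrib_left exp_sum)
  then have "fourier_coeff (\<lambda>x. \<Prod>j\<in>UNIV. \<psi> j (x $ j)) n * trig n x = (\<Prod>j\<in>UNIV. ?F j (n $ j))" for n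
    unfolding fourier_coeff_prod[OF assms] prod.distrib by (rule arg_cong)
  then have "delta_block (\<chi> j. Suc (e j)) (\<lambda>x. \<Prod>j\<in>UNIV. \<psi> j (x $ j)) x =
      (\<Sum>n\<in>vec_lambda ` PiE UNIV ?D. \<Prod>j\<in>UNIV. ?F j (n $ j))"
    unfolding delta_block_def D by (intro sum.cong refl)
  also have "\<dots> = (\<Sum>g\<in>PiE UNIV ?D. \<Prod>j\<in>UNIV. ?F j (g j))"
    by (subst sum.reindex) (auto simp: inj_on_def vec_lambda_inject)
  also have "\<dots> = (\<Prod>j\<in>UNIV. \<Sum>k\<in>?D j. ?F j k)"
    by (rule prod_sum_PiE[symmetric, OF finite fin])
  finally show ?thesis .
qed

text \<open>Only the conjugate pair k = 2^e and k = -2^e survives. Each member has weight a/2, and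
  Euler's formula gives the cosine.\<close>

lemma sum_dyadic_line:
  fixes c :: "int \<Rightarrow> complex"
  assumes "\<And>k. 2 ^ e \<le> \<bar>k\<bar> \<Longrightarrow> \<bar>k\<bar> < 2 ^ Suc e \<Longrightarrow> c k = (if \<bar>k\<bar> = 2 ^ e then of_real (pi * a) else 0)"
  shows "(\<Sum>k | 2 ^ e \<le> \<bar>k\<bar> \<and> \<bar>k\<bar> < 2 ^ Suc e. c k / (2 * pi) * exp (\<i> * of_real (of_int k * y)))
    = of_real (a * cos (2 ^ e * y))"
proof -
  let ?D = "{k::int. 2 ^ e \<le> \<bar>k\<bar> \<and> \<bar>k\<bar> < 2 ^ Suc e}"
  have fin: "finite ?D"
    by (rule finite_subset[of _ "{- (2 ^ Suc e) .. 2 ^ Suc e}"]) auto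
  have "(\<Sum>k\<in>?D. c k / (2 * pi) * exp (\<i> * of_real (of_int k * y)))
      = (\<Sum>k\<in>{2 ^ e, - (2 ^ e)}. c k / (2 * pi) * exp (\<i> * of_real (of_int k * y)))"
  proof (rule sum.mono_neutral_right[OF fin])
    show "\<forall>k\<in>?D - {2 ^ e, - (2 ^ e)}. c k / (2 * pi) * exp (\<i> * of_real (of_int k * y)) = 0"
    proof
      fix k assume k: "k \<in> ?D - {2 ^ e, - (2 ^ e)}"
      then have "\<bar>k\<bar> \<noteq> 2 ^ e" by auto
      with k assms[of k] show "c k / (2 * pi) * exp (\<i> * of_real (of_int k * y)) = 0"
        by simp
    qed
  qed auto
  also have "\<dots> = c (2 ^ e) / (2 * pi) * exp (\<i> * of_real (2 ^ e * y)) + c (- (2 ^ e)) / (2 * pi) * exp (- (\<i> * of_real (2 ^ e * y)))"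
    by (subst sum.insert) auto
  also have "\<dots> = of_real a * ((exp (\<i> * of_real (2 ^ e * y)) + exp (- (\<i> * of_real (2 ^ e * y)))) / 2)"
    using assms[of "2 ^ e"] assms[of "- (2 ^ e)"] by (simp add: field_simps)
  also have "(exp (\<i> * of_real (2 ^ e * y)) + exp (- (\<i> * of_real (2 ^ e * y)))) / 2 = of_real (cos (2 ^ e * y))"
    by (simp only: cos_of_real[symmetric] cos_exp_eq)
  finally show ?thesis
    by simp
qed

section \<open>Integrability of the logarithmic weight\<close>

lemma nn_integral_log_powr:
  assumes "\<kappa> > 0"
  shows "(\<integral>\<^sup>+ t \<in> {0<..1}. ennreal ((1 - log 2 t) powr (- 1 - \<kappa>) / t) \<partial>lborel) < \<infinity>"
proof -
  \<comment> \<open>An antiderivative that tends to 0 at 0. In the variable 1 - log 2 t the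
    integrand is a power below -1 on a half-line.\<close>
  define F where "F t = ln 2 / \<kappa> * (1 - log 2 t) powr (- \<kappa>)" for t :: real
  let ?f = "\<lambda>t. (1 - log 2 t) powr (- 1 - \<kappa>) / t"
  have "set_integrable lborel (einterval (ereal 0) (ereal 1)) ?f"
  proof (rule interval_integral_FTC_nonneg)
    show "DERIV F t :> ?f t" if "ereal 0 < ereal t" "ereal t < ereal 1" for t
    proof -
      have t: "0 < t" "t < 1" using that by auto
      then have "log 2 t < 0" by simp
      have "((\<lambda>t. 1 - log 2 t) has_real_derivative (0 - 1 / (ln 2 * t))) (at t)"
        using t by (intro DERIV_diff DERIV_const DERIV_log)
      then have "((\<lambda>t. (1 - log 2 t) powr (- \<kappa>)) has_real_derivative
          (- \<kappa>) * (1 - log 2 t) powr (- \<kappa> - of_nat 1) * (0 - 1 / (ln 2 * t))) (at t)"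
        by (rule DERIV_fun_powr) (use \<open>log 2 t < 0\<close> in simp)
      then have "DERIV F t :> ln 2 / \<kappa> * ((- \<kappa>) * (1 - log 2 t) powr (- \<kappa> - of_nat 1) * (0 - 1 / (ln 2 * t)))"
        unfolding F_def by (rule DERIV_cmult)
      also have "- \<kappa> - of_nat 1 = - 1 - \<kappa>"
        by simp
      also have "ln 2 / \<kappa> * ((- \<kappa>) * (1 - log 2 t) powr (- 1 - \<kappa>) * (0 - 1 / (ln 2 * t))) = ?f t"
        using assms t by simp
      finally show ?thesis .
    qed
    show "isCont ?f t" if "ereal 0 < ereal t" "ereal t < ereal 1" for t
    proof -
      have t: "0 < t" "t < 1" using that by auto
      then have "log 2 t < 0" by simp
      then have "log 2 t \<noteq> 1" by linarith
      with t show ?thesis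
        by (auto intro!: continuous_intros)
    qed
    show "AE t in lborel. ereal 0 < ereal t \<longrightarrow> ereal t < ereal 1 \<longrightarrow> 0 \<le> ?f t"
      by auto
    have "filterlim (\<lambda>t. - ln t :: real) at_top (at_right 0)"
      using ln_at_0 by (simp add: filterlim_uminus_at_bot)
    then have "filterlim (\<lambda>t. 1 / ln 2 * (- ln t) :: real) at_top (at_right 0)"
      by (rule filterlim_tendsto_pos_mult_at_top[OF tendsto_const, rotated]) simp
    then have "filterlim (\<lambda>t. 1 + 1 / ln 2 * (- ln t) :: real) at_top (at_right 0)"
      by (rule filterlim_tendsto_add_at_top[OF tendsto_const])
    then have "filterlim (\<lambda>t. 1 - log 2 t) at_top (at_right 0)"
      by (simp add: log_def)
    then have "(F \<longlongrightarrow> ln 2 / \<kappa> * 0) (at_right 0)"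
      unfolding F_def using assms by (intro tendsto_mult tendsto_const tendsto_neg_powr) auto
    then show "((F \<circ> real_of_ereal) \<longlongrightarrow> 0) (at_right (ereal 0))"
      unfolding ereal_tendsto_simps by simp
    have "isCont F 1"
      unfolding F_def using assms by (auto intro!: continuous_intros)
    then show "((F \<circ> real_of_ereal) \<longlongrightarrow> F 1) (at_left (ereal 1))"
      unfolding ereal_tendsto_simps isCont_def by (rule tendsto_within_subset) auto
  qed auto
  then have "(\<integral>\<^sup>+ t. ennreal (norm (indicator {0<..<1} t *\<^sub>R ?f t)) \<partial>lborel) < \<infinity>"
    unfolding set_integrable_def integrable_iff_bounded by simp
  also have "(\<integral>\<^sup>+ t. ennreal (norm (indicator {0<..<1} t *\<^sub>R ?f t)) \<partial>lborel) =
      (\<integral>\<^sup>+ t \<in> {0<..1}. ennreal (?f t) \<partial>lborel)"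
    by (rule nn_integral_cong_AE, use AE_lborel_singleton[of 1] in eventually_elim)
      (auto split: split_indicator)
  finally show ?thesis .
qed

section \<open>The counterexample\<close>

definition test_factor :: "'m \<Rightarrow> real \<Rightarrow> 'm \<Rightarrow> real \<Rightarrow> real" where
  "test_factor j0 \<eta> j = (if j = j0 then lac_series \<eta> else cos)"

definition test_fun :: "'m::finite \<Rightarrow> real \<Rightarrow> real ^ 'm \<Rightarrow> real" where
  "test_fun j0 \<eta> x = (\<Prod>j\<in>UNIV. test_factor j0 \<eta> j (x $ j))"

lemma test_factor_measurable [measurable]: "test_factor j0 \<eta> j \<in> borel_measurable borel"
  by (simp add: test_factor_def)

lemma test_fun_measurable [measurable]: "test_fun j0 \<eta> \<in> borel_measurable borel"
  unfolding test_fun_def [abs_def] by measurable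

lemma set_integrable_test_factor:
  assumes "\<eta> > 0"
  shows "set_integrable lborel {0..<2 * pi} (\<lambda>y. complex_of_real (test_factor j0 \<eta> j y) * exp (- (\<i> * of_real (of_int k * y))))"
proof (cases "j = j0")
  case True
  then show ?thesis
    using set_integrable_lac_series[OF assms] by (simp add: test_factor_def)
next
  case False
  then show ?thesis
    unfolding test_factor_def by (auto intro!: set_integrable_continuous_Ico continuous_intros)
qed

lemma line_coeff_test_factor_0:
  assumes "\<eta> > 0"
  shows "line_coeff (test_factor j0 \<eta> j) 0 = 0"
  using line_coeff_lac_series_0[OF assms, of 0] line_coeff_cos[of 1 0] by (simp add: test_factor_def)

lemma test_fun_in_lorentz_space0:
  fixes j0 :: "'m::finite"
  assumes "p > 0" "\<tau> > 0" "\<eta> > 0"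
  shows "test_fun j0 \<eta> \<in> lorentz_space0 p \<tau>"
proof -
  have "lorentz_norm p \<tau> (test_fun j0 \<eta>) \<le> ennreal (lorentz_const p \<tau> * (\<Prod>j\<in>(UNIV :: 'm set). 1))"
    unfolding test_fun_def [abs_def]
    by (rule lorentz_norm_prod_le[where i = j0 and B = "\<lambda>_. 1"])
      (use assms nn_integral_exp_lac_series in \<open>auto simp: test_factor_def\<close>)
  then have "lorentz_norm p \<tau> (test_fun j0 \<eta>) < \<infinity>"
    using le_less_trans by fastforce
  moreover have "test_fun j0 \<eta> (x + (2 * pi) *\<^sub>R axis j 1) = test_fun j0 \<eta> x" for x j
    unfolding test_fun_def
    by (rule prod.cong) (auto simp: axis_def test_factor_def lac_series_periodic)
  \<comment> \<open>The line integral is the zeroth coefficient of one factor times a number, so it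
    vanishes on every line and not only on almost all lines.\<close>
  moreover have "(LINT t:{0..<2 * pi}|lebesgue. test_fun j0 \<eta> (\<chi> i. if i = j then t else x $ i)) = 0" for j x
  proof -
    have "test_fun j0 \<eta> (\<chi> i. if i = j then t else x $ i) =
        test_factor j0 \<eta> j t * (\<Prod>i\<in>UNIV - {j}. test_factor j0 \<eta> i (x $ i))" for t
      unfolding test_fun_def by (subst prod.remove[of _ j]) auto
    then have "(LINT t:{0..<2 * pi}|lebesgue. test_fun j0 \<eta> (\<chi> i. if i = j then t else x $ i)) =
        (LINT t:{0..<2 * pi}|lebesgue. test_factor j0 \<eta> j t) * (\<Prod>i\<in>UNIV - {j}. test_factor j0 \<eta> i (x $ i))"
      by (simp add: set_integral_mult_left)
    also have "(LINT t:{0..<2 * pi}|lebesgue. test_factor j0 \<eta> j t) = (LBINT t:{0..<2 * pi}. test_factor j0 \<eta> j t)"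
      unfolding set_lebesgue_integral_def by (rule integral_completion) simp
    also have "complex_of_real \<dots> = line_coeff (test_factor j0 \<eta> j) 0"
      by (simp add: line_coeff_def set_integral_complex_of_real)
    then have "(LBINT t:{0..<2 * pi}. test_factor j0 \<eta> j t) = 0"
      by (simp add: line_coeff_test_factor_0 assms)
    finally show ?thesis
      by simp
  qed
  ultimately show ?thesis
    by (simp add: lorentz_space0_def lorentz_space_def measurable_completion)
qed

text \<open>The cosine factors decay faster than any power of the logarithm, so the exponents at
  coordinates other than \<open>j0\<close> are free. They are kept as a family to be matched with
  \<open>b\<close> later.\<close>

lemma mixed_modulus_test_fun_le:
  fixes k :: "nat ^ 'm" and t :: "real ^ 'm"
  assumes "p > 0" "\<tau> > 0" and k: "\<And>j. 1 \<le> k $ j" and eta: "\<And>j. \<eta> j > 0"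
    and t: "\<And>j. 0 < t $ j" "\<And>j. t $ j \<le> 1"
  shows "mixed_modulus k p \<tau> (test_fun j0 (\<eta> j0)) t \<le> ennreal (lorentz_const p \<tau> *
    (\<Prod>j\<in>UNIV. 2 ^ (k $ j) * sqrt (mod_const (\<eta> j)) * (1 - log 2 (t $ j)) powr (- \<eta> j)))"
  unfolding mixed_modulus_def
proof (rule SUP_least)
  fix h :: "real ^ 'm" assume "h \<in> {h. \<forall>j. \<bar>h $ j\<bar> \<le> t $ j}"
  then have h: "\<bar>h $ j\<bar> \<le> t $ j" for j
    by simp
  define B where "B j = 2 ^ (k $ j) * sqrt (mod_const (\<eta> j)) * (1 - log 2 (t $ j)) powr (- \<eta> j)" for j
  have "B j > 0" for j
  proof -
    have "log 2 (t $ j) \<le> 0"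
      using t[of j] by simp
    then show ?thesis
      using mod_const_pos[of "\<eta> j"] by (simp add: B_def)
  qed
  moreover have "\<bar>(fdiff (h $ j) ^^ (k $ j)) (test_factor j0 (\<eta> j0) j) y\<bar> \<le> B j" if "j \<noteq> j0" for j y
  proof -
    have "(fdiff (h $ j) ^^ (k $ j)) (test_factor j0 (\<eta> j0) j) y =
        (2 * sin (h $ j / 2)) ^ (k $ j) * cos (y + real (k $ j) * (h $ j / 2 + pi / 2))"
      using funpow_fdiff_cos[of "k $ j" "h $ j" 1 0] that by (simp add: test_factor_def)
    then have "\<bar>(fdiff (h $ j) ^^ (k $ j)) (test_factor j0 (\<eta> j0) j) y\<bar> =
        \<bar>(2 * sin (h $ j / 2)) ^ (k $ j)\<bar> * \<bar>cos (y + real (k $ j) * (h $ j / 2 + pi / 2))\<bar>"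
      by (simp only: abs_mult)
    also have "\<dots> \<le> \<bar>(2 * sin (h $ j / 2)) ^ (k $ j)\<bar> * 1"
      by (intro mult_left_mono abs_cos_le_one abs_ge_zero)
    also have "\<dots> \<le> B j"
      using abs_two_sin_power_le_mod_const[OF k eta t(1) t(2) h, of j] by (simp add: B_def)
    finally show ?thesis .
  qed
  moreover have "(\<integral>\<^sup>+ y \<in> {0..<1}. ennreal (exp (\<bar>(fdiff (h $ j0) ^^ (k $ j0)) (test_factor j0 (\<eta> j0) j0) (2 * pi * y)\<bar> / B j0)) \<partial>lborel) \<le> 4"
    using nn_integral_exp_fdiff_lac_series[OF k eta t(1) t(2) h, of j0] by (simp add: B_def test_factor_def)
  ultimately have "lorentz_norm p \<tau> (\<lambda>x. \<Prod>j\<in>UNIV. (fdiff (h $ j) ^^ (k $ j)) (test_factor j0 (\<eta> j0) j) (x $ j))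
      \<le> ennreal (lorentz_const p \<tau> * (\<Prod>j\<in>UNIV. B j))"
    using assms(1,2) by (intro lorentz_norm_prod_le[of _ _ _ j0]) auto
  then show "lorentz_norm p \<tau> (mixed_diff k h (test_fun j0 (\<eta> j0))) \<le> ennreal (lorentz_const p \<tau> *
    (\<Prod>j\<in>UNIV. 2 ^ (k $ j) * sqrt (mod_const (\<eta> j)) * (1 - log 2 (t $ j)) powr (- \<eta> j)))"
    unfolding test_fun_def [abs_def] mixed_diff_prod B_def .
qed

lemma test_fun_in_besov_mod:
  fixes k :: "nat ^ 'm" and b :: "real ^ 'm"
  assumes "p > 0" "\<tau> > 0" "q > 0" "\<epsilon> > 0" and k: "\<And>j. 1 \<le> k $ j"
    and b: "\<And>j. b $ j > - (1 / q)"
  shows "test_fun j0 (b $ j0 + 1 / q + \<epsilon>) \<in> besov_mod k p \<tau> (ereal q) b"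
proof -
  \<comment> \<open>Chosen in each coordinate so that the decay and the weight combine to the
    exponent -1 - q\<epsilon>. The integral then factors into equal convergent integrals.\<close>
  define \<eta> where "\<eta> j = b $ j + 1 / q + \<epsilon>" for j
  have eta: "\<eta> j > 0" for j
    using b[of j] assms(4) unfolding \<eta>_def by linarith
  let ?f = "test_fun j0 (\<eta> j0)"
  have f0: "?f \<in> lorentz_space0 p \<tau>"
    by (intro test_fun_in_lorentz_space0 assms eta)
  define K where "K = lorentz_const p \<tau> * (\<Prod>j\<in>UNIV. 2 ^ (k $ j) * sqrt (mod_const (\<eta> j)))"
  have K: "K \<ge> 0"
    unfolding K_def lorentz_const_def using assms mod_const_pos
    by (intro mult_nonneg_nonneg prod_nonneg) (auto intro: less_imp_le)
  define g where "g s = ennreal ((1 - log 2 s) powr (- 1 - q * \<epsilon>) / s) * indicator {0<..1} s" for s :: real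
  have bound: "enn_powr (mixed_modulus k p \<tau> ?f t) q *
        ennreal (\<Prod>j\<in>UNIV. (1 - log 2 (t $ j)) powr (q * b $ j) / t $ j) \<le> ennreal (K powr q) * (\<Prod>j\<in>UNIV. g (t $ j))"
    if t: "\<And>j. 0 < t $ j" "\<And>j. t $ j \<le> 1" for t :: "real ^ 'm"
  proof -
    have "enn_powr (mixed_modulus k p \<tau> ?f t) q \<le> enn_powr (ennreal (lorentz_const p \<tau> *
        (\<Prod>j\<in>UNIV. 2 ^ (k $ j) * sqrt (mod_const (\<eta> j)) * (1 - log 2 (t $ j)) powr (- \<eta> j)))) q"
      using assms by (intro enn_powr_mono mixed_modulus_test_fun_le eta t) auto
    also have "lorentz_const p \<tau> * (\<Prod>j\<in>UNIV. 2 ^ (k $ j) * sqrt (mod_const (\<eta> j)) * (1 - log 2 (t $ j)) powr (- \<eta> j))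
      = K * (\<Prod>j\<in>UNIV. (1 - log 2 (t $ j)) powr (- \<eta> j))"
      by (simp add: K_def prod.distrib)
    also have "enn_powr (ennreal \<dots>) q = ennreal ((K * (\<Prod>j\<in>UNIV. (1 - log 2 (t $ j)) powr (- \<eta> j))) powr q)"
      using K by (intro enn_powr_ennreal mult_nonneg_nonneg prod_nonneg) auto
    also have "(K * (\<Prod>j\<in>UNIV. (1 - log 2 (t $ j)) powr (- \<eta> j))) powr q
      = K powr q * (\<Prod>j\<in>UNIV. (1 - log 2 (t $ j)) powr (- \<eta> j * q))"
      using K by (simp add: powr_mult prod_nonneg prod_powr_distrib powr_powr)
    finally have "enn_powr (mixed_modulus k p \<tau> ?f t) q *
        ennreal (\<Prod>j\<in>UNIV. (1 - log 2 (t $ j)) powr (q * b $ j) / t $ j) \<le>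
        ennreal (K powr q * (\<Prod>j\<in>UNIV. (1 - log 2 (t $ j)) powr (- \<eta> j * q))) *
        ennreal (\<Prod>j\<in>UNIV. (1 - log 2 (t $ j)) powr (q * b $ j) / t $ j)"
      by (rule mult_right_mono) simp
    also have "\<dots> = ennreal (K powr q * ((\<Prod>j\<in>UNIV. (1 - log 2 (t $ j)) powr (- \<eta> j * q)) *
        (\<Prod>j\<in>UNIV. (1 - log 2 (t $ j)) powr (q * b $ j) / t $ j)))"
      by (subst ennreal_mult'[symmetric]) (auto simp: mult.assoc intro!: prod_nonneg mult_nonneg_nonneg)
    also have "(\<Prod>j\<in>UNIV. (1 - log 2 (t $ j)) powr (- \<eta> j * q)) *
        (\<Prod>j\<in>UNIV. (1 - log 2 (t $ j)) powr (q * b $ j) / t $ j) =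
        (\<Prod>j\<in>UNIV. (1 - log 2 (t $ j)) powr (- 1 - q * \<epsilon>) / t $ j)"
    proof -
      have "- \<eta> j * q + q * b $ j = - 1 - q * \<epsilon>" for j
        using assms(3) by (simp add: \<eta>_def field_simps)
      then show ?thesis
        unfolding prod.distrib[symmetric] by (intro prod.cong) (simp_all add: powr_add[symmetric])
    qed
    also have "ennreal (K powr q * (\<Prod>j\<in>UNIV. (1 - log 2 (t $ j)) powr (- 1 - q * \<epsilon>) / t $ j)) =
        ennreal (K powr q) * (\<Prod>j\<in>UNIV. ennreal ((1 - log 2 (t $ j)) powr (- 1 - q * \<epsilon>) / t $ j))"
      using t(1) by (subst prod_ennreal) (auto simp: less_imp_le intro!: ennreal_mult prod_nonneg)
    also have "(\<Prod>j\<in>UNIV. ennreal ((1 - log 2 (t $ j)) powr (- 1 - q * \<epsilon>) / t $ j)) = (\<Prod>j\<in>UNIV. g (t $ j))"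
      using t by (simp add: g_def)
    finally show ?thesis .
  qed
  have "(\<integral>\<^sup>+ t \<in> {t. \<forall>j. 0 < t $ j \<and> t $ j \<le> 1}. enn_powr (mixed_modulus k p \<tau> ?f t) q *
        ennreal (\<Prod>j\<in>UNIV. (1 - log 2 (t $ j)) powr (q * b $ j) / t $ j) \<partial>lebesgue)
      \<le> (\<integral>\<^sup>+ t. ennreal (K powr q) * (\<Prod>j\<in>UNIV. g (t $ j)) \<partial>(lebesgue :: (real ^ 'm) measure))"
    by (intro nn_integral_mono) (auto split: split_indicator intro: bound)
  also have "\<dots> = ennreal (K powr q) * (\<integral>\<^sup>+ t. (\<Prod>j\<in>UNIV. g (t $ j)) \<partial>(lborel :: (real ^ 'm) measure))"
    unfolding nn_integral_completion by (rule nn_integral_cmult) (simp add: g_def)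
  also have "(\<integral>\<^sup>+ t. (\<Prod>j\<in>UNIV. g (t $ j)) \<partial>(lborel :: (real ^ 'm) measure)) = (\<Prod>j\<in>(UNIV :: 'm set). \<integral>\<^sup>+ s. g s \<partial>lborel)"
    by (rule nn_integral_lborel_vec_prod) (simp add: g_def)
  also have "ennreal (K powr q) * \<dots> < \<infinity>"
  proof -
    have "(\<integral>\<^sup>+ s. g s \<partial>lborel) < \<infinity>"
      using nn_integral_log_powr[of "q * \<epsilon>"] assms(3,4) by (simp add: g_def)
    then obtain R where R: "R \<ge> 0" "(\<integral>\<^sup>+ s. g s \<partial>lborel) = ennreal R"
      by (cases "\<integral>\<^sup>+ s. g s \<partial>lborel" rule: ennreal_cases) auto
    show ?thesis
      unfolding R(2) using R(1) by (simp add: ennreal_power ennreal_mult_less_top)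
  qed
  finally have "(\<integral>\<^sup>+ t \<in> {t. \<forall>j. 0 < t $ j \<and> t $ j \<le> 1}. enn_powr (mixed_modulus k p \<tau> ?f t) q *
        ennreal (\<Prod>j\<in>UNIV. (1 - log 2 (t $ j)) powr (q * b $ j) / t $ j) \<partial>lebesgue) < \<infinity>" .
  from enn_powr_less_top[OF this, of "1 / q"] have "besov_mod_norm k p \<tau> (ereal q) b ?f < \<infinity>"
    using f0 by (simp add: besov_mod_norm_def lorentz_space0_def lorentz_space_def)
  with f0 show ?thesis
    by (simp add: besov_mod_def \<eta>_def)
qed

text \<open>The band at \<open>j0\<close> contains 2^n and no other power of 2, and the other bands
  contain only 1 and -1. The block of the test function is therefore a single product of cosines
  with amplitude \<open>lac_coeff \<eta> n\<close>.\<close>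

lemma lorentz_norm_delta_test_fun_ge:
  fixes j0 :: "'m::finite"
  assumes "p > 0" "\<tau> > 0" "\<eta> > 0"
  defines "\<kappa> \<equiv> (1 / 2) ^ Suc CARD('m)"
  shows "ennreal (lac_coeff \<eta> n * sqrt \<kappa> * \<kappa> powr (1 / p)) \<le>
    lorentz_norm p \<tau> (delta_block (\<chi> j. Suc (if j = j0 then n else 0)) (test_fun j0 \<eta>))"
  unfolding \<kappa>_def
proof (rule lorentz_norm_prod_cos_ge[OF assms(1,2) lac_coeff_nonneg[OF assms(3)],
      where e = "\<lambda>j. if j = j0 then n else 0"])
  fix x :: "real ^ 'm"
  let ?e = "\<lambda>j. if j = j0 then n else 0"
  let ?a = "\<lambda>j. if j = j0 then lac_coeff \<eta> n else 1"
  have "delta_block (\<chi> j. Suc (?e j)) (test_fun j0 \<eta>) x =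
      (\<Prod>j\<in>UNIV. \<Sum>k | 2 ^ ?e j \<le> \<bar>k\<bar> \<and> \<bar>k\<bar> < 2 ^ Suc (?e j).
        line_coeff (test_factor j0 \<eta> j) k / (2 * pi) * exp (\<i> * of_real (of_int k * (x $ j))))"
    unfolding test_fun_def [abs_def]
    by (rule delta_block_prod[OF test_factor_measurable set_integrable_test_factor[OF assms(3)]])
  also have "\<dots> = (\<Prod>j\<in>UNIV. complex_of_real (?a j * cos (2 ^ ?e j * (x $ j))))"
  proof (intro prod.cong refl sum_dyadic_line)
    fix j :: 'm and k :: int
    assume k: "2 ^ ?e j \<le> \<bar>k\<bar>" "\<bar>k\<bar> < 2 ^ Suc (?e j)"
    show "line_coeff (test_factor j0 \<eta> j) k = (if \<bar>k\<bar> = 2 ^ ?e j then of_real (pi * ?a j) else 0)"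
    proof (cases "j = j0")
      case False
      with k have "\<bar>k\<bar> = 1" by simp
      with False line_coeff_cos[of 1 k] show ?thesis
        by (simp add: test_factor_def)
    next
      case True
      show ?thesis
      proof (cases "\<bar>k\<bar> = 2 ^ n")
        case True
        with \<open>j = j0\<close> line_coeff_lac_series[OF assms(3) True] show ?thesis
          by (simp add: test_factor_def)
      next
        case False
        have "\<bar>k\<bar> \<noteq> 2 ^ l" for l
        proof
          assume l: "\<bar>k\<bar> = 2 ^ l"
          with k True have "(2::int) ^ n \<le> 2 ^ l" "(2::int) ^ l < 2 ^ Suc n"
            by auto
          then have "n \<le> l" "l < Suc n"
            by (simp_all only: power_increasing_iff power_strict_increasing_iff one_less_numeral_iff semiring_norm)
          with l False show False
            by simp
        qed
        with True False show ?thesis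
          by (simp add: test_factor_def line_coeff_lac_series_0 assms)
      qed
    qed
  qed
  also have "\<dots> = complex_of_real ((\<Prod>j\<in>UNIV. ?a j) * (\<Prod>j\<in>UNIV. cos (2 ^ ?e j * (x $ j))))"
    by (simp only: of_real_prod[symmetric] prod.distrib)
  also have "(\<Prod>j\<in>UNIV. ?a j) = lac_coeff \<eta> n"
    by simp
  finally show "norm (delta_block (\<chi> j. Suc (?e j)) (test_fun j0 \<eta>) x) =
      lac_coeff \<eta> n * (\<Prod>j\<in>UNIV. \<bar>cos (2 ^ ?e j * (x $ j))\<bar>)"
    by (simp only: norm_of_real abs_mult abs_prod abs_of_nonneg[OF lac_coeff_nonneg[OF assms(3)]])
qed

text \<open>All terms are nonnegative, so the subfamily along \<open>s\<close> bounds the whole sum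
  from below, and its partial sums are harmonic.\<close>

lemma infsum_ennreal_eq_top:
  fixes F :: "'a \<Rightarrow> ennreal"
  assumes "inj s" "c > 0" and le: "\<And>n :: nat. ennreal (c / (real n + 2)) \<le> F (s n)"
  shows "infsum F UNIV = \<infinity>"
proof (rule ccontr)
  assume "infsum F UNIV \<noteq> \<infinity>"
  then obtain B where B: "B \<ge> 0" "infsum F UNIV = ennreal B"
    by (cases "infsum F UNIV" rule: ennreal_cases) auto
  have bound: "(\<Sum>n<N. c / (real n + 2)) \<le> B" for N
  proof -
    have "ennreal (\<Sum>n<N. c / (real n + 2)) = (\<Sum>n<N. ennreal (c / (real n + 2)))"
      using assms(2) by (subst sum_ennreal) auto
    also have "\<dots> \<le> (\<Sum>n<N. F (s n))"
      by (intro sum_mono le)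
    also have "\<dots> = infsum F (s ` {..<N})"
      using assms(1) by (simp add: sum.reindex inj_on_subset)
    also have "\<dots> \<le> infsum F UNIV"
      by (rule infsum_mono_neutral) (auto intro: nonneg_summable_on_complete)
    finally show ?thesis
      using B by simp
  qed
  have "summable (\<lambda>n. c / (real n + 2))"
  proof (rule bounded_imp_summable)
    show "(\<Sum>n\<le>N. c / (real n + 2)) \<le> B" for N
      using bound[of "Suc N"] unfolding lessThan_Suc_atMost .
  qed (use assms(2) in simp)
  then have "summable (\<lambda>n. c * inverse (real (n + 2)))"
    by (simp add: divide_inverse add.commute)
  then have "summable (\<lambda>n. inverse (real (n + 2)))"
    using assms(2) by (simp add: summable_cmult_iff)
  then have "summable (\<lambda>n. inverse (real n))"
    by (subst (asm) summable_iff_shift)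
  then show False
    using not_summable_harmonic[where 'a = real] by simp
qed

text \<open>Only blocks along the direction \<open>j0\<close> are kept. The assumption on
  \<open>r\<close> makes the exponents of the weight and of the coefficient add up to -1 after
  multiplication by \<open>q\<close>.\<close>

lemma test_fun_not_in_besov_block:
  fixes b r :: "real ^ 'm"
  assumes "p > 0" "\<tau> > 0" "q > 0" "\<eta> > 0" and r: "r $ j0 = \<eta> + 1/2 - 1 / q"
  shows "test_fun j0 \<eta> \<notin> besov_block p \<tau> (ereal q) r"
proof -
  define \<kappa> :: real where "\<kappa> = (1 / 2) ^ Suc CARD('m)"
  define s :: "nat \<Rightarrow> nat ^ 'm" where "s n = (\<chi> j. Suc (if j = j0 then n else 0))" for n
  define F where "F s = ennreal (\<Prod>j\<in>UNIV. (real (s $ j) + 1) powr (r $ j * q)) *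
      enn_powr (lorentz_norm p \<tau> (delta_block s (test_fun j0 \<eta>))) q" for s :: "nat ^ 'm"
  define D where "D = (\<Prod>j\<in>UNIV - {j0}. 2 powr (r $ j * q))"
  define A where "A = sqrt (2 * \<eta>) * sqrt \<kappa> * \<kappa> powr (1 / p)"
  have k: "\<kappa> > 0" by (simp add: \<kappa>_def)
  have D: "D > 0" by (auto simp: D_def intro: prod_pos)
  have A: "A > 0" using k assms by (simp add: A_def)
  have "inj s"
    by (auto simp: inj_def s_def vec_eq_iff split: if_splits)
  have "ennreal (D * A powr q / (real n + 2)) \<le> F (s n)" for n
  proof -
    \<comment> \<open>The index at \<open>j0\<close> is n + 1, so the weight has base n + 2, the
      same as in \<open>lac_coeff_ge\<close>, and the powers combine without loss. The other indices
      are 1 and contribute the fixed factor \<open>D\<close>.\<close>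
    have prod: "(\<Prod>j\<in>UNIV. (real (s n $ j) + 1) powr (r $ j * q)) = (real n + 2) powr (r $ j0 * q) * D"
      unfolding D_def s_def by (subst prod.remove[of _ j0]) (auto simp: add.commute)
    have "A * (real n + 2) powr (- \<eta> - 1/2) = (sqrt (2 * \<eta>) * (real n + 2) powr (- \<eta> - 1/2)) * (sqrt \<kappa> * \<kappa> powr (1 / p))"
      by (simp add: A_def)
    also have "\<dots> \<le> lac_coeff \<eta> n * (sqrt \<kappa> * \<kappa> powr (1 / p))"
      using k by (intro mult_right_mono lac_coeff_ge assms) auto
    finally have "ennreal (A * (real n + 2) powr (- \<eta> - 1/2)) \<le> lorentz_norm p \<tau> (delta_block (s n) (test_fun j0 \<eta>))"
      using lorentz_norm_delta_test_fun_ge[OF assms(1,2,4), of n j0]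
      unfolding s_def \<kappa>_def[symmetric] mult.assoc[of "lac_coeff \<eta> n"] by (meson ennreal_leI order_trans)
    then have "enn_powr (ennreal (A * (real n + 2) powr (- \<eta> - 1/2))) q \<le>
        enn_powr (lorentz_norm p \<tau> (delta_block (s n) (test_fun j0 \<eta>))) q"
      using assms by (intro enn_powr_mono) auto
    moreover have "enn_powr (ennreal (A * (real n + 2) powr (- \<eta> - 1/2))) q =
        ennreal (A powr q * (real n + 2) powr ((- \<eta> - 1/2) * q))"
      using A by (simp add: enn_powr_ennreal powr_mult powr_powr)
    ultimately have "ennreal ((real n + 2) powr (r $ j0 * q) * D) *
        ennreal (A powr q * (real n + 2) powr ((- \<eta> - 1/2) * q)) \<le> F (s n)"
      unfolding F_def prod by (intro mult_left_mono) auto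
    also have "ennreal ((real n + 2) powr (r $ j0 * q) * D) * ennreal (A powr q * (real n + 2) powr ((- \<eta> - 1/2) * q))
      = ennreal (D * A powr q * ((real n + 2) powr (r $ j0 * q) * (real n + 2) powr ((- \<eta> - 1/2) * q)))"
      using D by (subst ennreal_mult[symmetric]) (auto simp: mult_ac)
    also have "(real n + 2) powr (r $ j0 * q) * (real n + 2) powr ((- \<eta> - 1/2) * q) = 1 / (real n + 2)"
    proof -
      have "r $ j0 * q + (- \<eta> - 1/2) * q = - 1"
        unfolding r using assms(3) by (simp add: field_simps)
      then show ?thesis
        unfolding powr_add[symmetric] by (simp add: powr_minus_divide)
    qed
    finally show ?thesis
      by simp
  qed
  then have "infsum F UNIV = \<infinity>"
    using \<open>inj s\<close> D A by (intro infsum_ennreal_eq_top[of s "D * A powr q"]) auto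
  then have "besov_block_norm p \<tau> (ereal q) r (test_fun j0 \<eta>) = \<infinity>"
    by (simp add: besov_block_norm_def F_def [abs_def] enn_powr_def)
  then show ?thesis
    by (simp add: besov_block_def)
qed

theorem theorem4p5:
  fixes p \<tau> \<gamma> \<epsilon> :: real and \<theta> :: ereal
    and k :: "nat ^ 'm" and b u :: "real ^ 'm" and j0 :: 'm
  assumes "1 < p" and "1 < \<tau>" and "0 < \<theta>"
    and "\<And>j. 1 \<le> k $ j"
    and "\<And>j. ereal (b $ j) > - (1 / \<theta>)"
    and "(1 < \<tau> \<and> \<tau> \<le> 2 \<and> 1 < p) \<or> (2 < \<tau> \<and> 2 < p)"
    and "\<gamma> = (if \<tau> \<le> 2 then 2 else \<tau>)"
    and "u = (\<chi> j. b $ j + real_of_ereal (1 / max (ereal \<gamma>) \<theta>))"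
    and "max (ereal \<gamma>) \<theta> = 2"
    and "\<epsilon> > 0"
  shows "\<not> besov_mod k p \<tau> \<theta> b \<subseteq> besov_block p \<tau> \<theta> (u + \<epsilon> *\<^sub>R axis j0 1)"
proof
  assume sub: "besov_mod k p \<tau> \<theta> b \<subseteq> besov_block p \<tau> \<theta> (u + \<epsilon> *\<^sub>R axis j0 1)"
  \<comment> \<open>Hence \<theta> is finite, and both norms are given by their sum and integral
    branches.\<close>
  have "\<theta> \<le> 2"
    using assms(9) max.cobounded2[of \<theta> "ereal \<gamma>"] by simp
  with assms(3) obtain q where q: "\<theta> = ereal q" "q > 0"
    by (cases \<theta>) auto
  have b: "b $ j > - (1 / q)" for j
    using assms(5)[of j] q by (simp add: one_ereal_def)
  define \<eta> where "\<eta> = b $ j0 + 1 / q + \<epsilon>"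
  have "\<eta> > 0"
    using b[of j0] assms(10) by (simp add: \<eta>_def)
  have "real_of_ereal (1 / 2) = 1 / 2"
    by (simp add: one_ereal_def)
  \<comment> \<open>Both sides equal b + 1/2 + \<epsilon> at \<open>j0\<close>: the 1/q inside
    \<eta> cancels, and the 1/2 comes from the maximum being 2.\<close>
  then have "(u + \<epsilon> *\<^sub>R axis j0 1) $ j0 = \<eta> + 1/2 - 1 / q"
    unfolding assms(8) assms(9) by (simp add: \<eta>_def axis_def)
  then have "test_fun j0 \<eta> \<notin> besov_block p \<tau> \<theta> (u + \<epsilon> *\<^sub>R axis j0 1)"
    unfolding q(1) using assms \<open>\<eta> > 0\<close> q(2) by (intro test_fun_not_in_besov_block) auto
  moreover have "test_fun j0 \<eta> \<in> besov_mod k p \<tau> \<theta> b"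
    unfolding q(1) \<eta>_def using assms b q(2) by (intro test_fun_in_besov_mod) auto
  ultimately show False
    using sub by blast
qed

end
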